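(* For every $D>0$ and $c>0$ there are a constant $\delta>0$ and a threshold $n_0=n_0(c,D)$ such that the following holds. Let $A$ be a set of $n$ points in the plane in convex position, and let $E\subseteq A\times A$ be a set of pairs of points whose connecting lines determine at most $Dn$ distinct directions. If $|A|\ge n_0$ and $|E|\ge cn^2$, then there is $H\subseteq E$ with $|H|\ge \delta n^2$ such that all points appearing in the pairs of $H$ lie on a single conic.
   Context: The direction determined by a pair of distinct points is the direction (slope) of the line through them. *)

theory Defs
  imports "HOL-Analysis.Analysis"
begin

definition convex_position :: "(real ^ 2) set \<Rightarrow> bool" where
  "convex_position A \<longleftrightarrow> (\<forall>p\<in>A. p \<notin> convex hull (A - {p}))"

text \<open>
  A direction is represented by the one-dimensional linear subspace parallel to the line,
  so that vertical lines need no separate treatment. It is meaningful for distinct points only.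
\<close>
definition direction :: "real ^ 2 \<Rightarrow> real ^ 2 \<Rightarrow> (real ^ 2) set" where
  "direction p q = span {q - p}"

text \<open>A diagonal pair has no connecting line and contributes no direction.\<close>
definition directions :: "((real ^ 2) \<times> (real ^ 2)) set \<Rightarrow> (real ^ 2) set set" where
  "directions E = {direction p q | p q. (p, q) \<in> E \<and> p \<noteq> q}"

text \<open>
  The real zero set of a polynomial of degree exactly two; degenerate conics are included.
\<close>
definition is_conic :: "(real ^ 2) set \<Rightarrow> bool" where
  "is_conic C \<longleftrightarrow> (\<exists>a b c d e f :: real. (a, b, c) \<noteq> (0, 0, 0) \<and>
     C = {p. a * (p $ 1)\<^sup>2 + b * (p $ 1) * (p $ 2) + c * (p $ 2)\<^sup>2
             + d * (p $ 1) + e * (p $ 2) + f = 0})"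

end

theory Submission
  imports Defs
begin

text \<open>
  By Pascal's theorem, points \<open>a\<^sub>1, a\<^sub>2, a\<^sub>3, b\<^sub>1, b\<^sub>2, b\<^sub>3\<close> with \<open>a\<^sub>i b\<^sub>j\<close> parallel to \<open>a\<^sub>j b\<^sub>i\<close> for all \<open>i \<noteq> j\<close> lie on
  a conic, and apart from centrally symmetric ones the same holds for such configurations of any size.
  After restricting to two arcs of \<open>A\<close> separated by a line, the slope of \<open>a\<^sub>i b\<^sub>j\<close> is increasing in \<open>i\<close> and
  in \<open>j\<close>. Hence most pairs of blocks of constant length again see few directions, and by pigeonhole many
  block pairs carry the same pattern of ranks of directions. A configuration of size \<open>k\<close> that recurs
  in this way defines a properly coloured dense graph on the blocks. By the Ruzsa-Szemeredi induced matching theorem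
  one of its edges \<open>(u, v)\<close> joins two edges \<open>(u, v')\<close>, \<open>(u', v)\<close> of the same colour, and adding a point of
  \<open>u'\<close> and one of \<open>v'\<close> yields a configuration of size \<open>k + 1\<close>. For \<open>k = 5\<close> a recurring configuration
  assigns conics to a dense set of block pairs, since a block is centrally symmetric to at most one other
  (two translates of a triangle are not in convex position). Each conic is determined by either of
  the two blocks, so the conics of a dense part agree.
\<close>

section \<open>Induced matchings\<close>

text \<open>Size five is chosen for uniqueness: five points of one block, no three of them
  collinear, determine the conic, which allows conics of different block pairs to be compared.
  Central symmetry is a genuine obstacle: if \<open>b i = t - a i\<close> for all \<open>i\<close>,
  every required parallelism holds and nothing forces a conic. A colour is the value of
  \<open>f\<close> at the corner of a block pair. Recurring block pairs share one table of offsets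
  from that value, so a single coincidence of colours yields at once all the parallel lines that a
  new index has to satisfy. The induced matching theorem is proved by energy increment. If a colour
  occupies many rows and many columns of a product cell, these span a rectangle in which all edges
  have that colour, hence at most one per row. A dense cell thus contains a large, nearly empty
  rectangle, and cutting along it raises the energy, which is bounded.\<close>

definition cell_avg :: "'a set \<Rightarrow> ('a \<Rightarrow> 'l) \<Rightarrow> ('a \<Rightarrow> real) \<Rightarrow> 'l \<Rightarrow> real" where
  "cell_avg \<Omega> lam f l = (\<Sum>w\<in>{w\<in>\<Omega>. lam w = l}. f w) / real (card {w\<in>\<Omega>. lam w = l})"

text \<open>Squared L2 norm of the conditional expectation of \<open>f\<close> given
  \<open>lam\<close>: the index of a partition in the regularity method, without normalisation.
  Partitions are encoded by labellings, their cells being the fibres.\<close>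

definition energy :: "'a set \<Rightarrow> ('a \<Rightarrow> 'l) \<Rightarrow> ('a \<Rightarrow> real) \<Rightarrow> real" where
  "energy \<Omega> lam f = (\<Sum>w\<in>\<Omega>. (cell_avg \<Omega> lam f (lam w))\<^sup>2)"

text \<open>Averaging over cells is self-adjoint and fixes functions of the label, so testing
  against such a function cannot tell \<open>f\<close> from its average. It is applied to indicators
  of unions of cells and to averages over a coarser partition.\<close>

lemma sum_cell_avg:
  assumes "finite \<Omega>"
  shows "(\<Sum>w\<in>\<Omega>. cell_avg \<Omega> lam f (lam w) * h (lam w)) = (\<Sum>w\<in>\<Omega>. f w * h (lam w))"
proof -
  have *: "(\<Sum>w\<in>{w\<in>\<Omega>. lam w = l}. cell_avg \<Omega> lam f (lam w) * h (lam w))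
      = (\<Sum>w\<in>{w\<in>\<Omega>. lam w = l}. f w * h (lam w))" if "l \<in> lam ` \<Omega>" for l
  proof -
    let ?C = "{w\<in>\<Omega>. lam w = l}"
    have "card ?C \<noteq> 0" using assms that by auto
    have "(\<Sum>w\<in>?C. cell_avg \<Omega> lam f (lam w) * h (lam w)) = (\<Sum>w\<in>?C. cell_avg \<Omega> lam f l * h l)"
      by (rule sum.cong) auto
    also have "\<dots> = (\<Sum>w\<in>?C. f w) * h l"
      using \<open>card ?C \<noteq> 0\<close> by (simp add: cell_avg_def)
    also have "\<dots> = (\<Sum>w\<in>?C. f w * h (lam w))"
      by (simp add: sum_distrib_right)
    finally show ?thesis .
  qed
  show ?thesis
    unfolding sum.image_gen[OF assms, of "\<lambda>w. cell_avg \<Omega> lam f (lam w) * h (lam w)" lam]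
      sum.image_gen[OF assms, of "\<lambda>w. f w * h (lam w)" lam]
    by (rule sum.cong[OF refl *])
qed

lemma energy_le_card:
  assumes "finite \<Omega>" and "\<And>w. w \<in> \<Omega> \<Longrightarrow> 0 \<le> f w \<and> f w \<le> 1"
  shows "energy \<Omega> lam f \<le> real (card \<Omega>)"
proof -
  have "0 \<le> cell_avg \<Omega> lam f l \<and> cell_avg \<Omega> lam f l \<le> 1" for l
  proof -
    have "(\<Sum>w\<in>{w\<in>\<Omega>. lam w = l}. f w) \<le> (\<Sum>w\<in>{w\<in>\<Omega>. lam w = l}. 1)"
      using assms by (intro sum_mono) auto
    moreover have "0 \<le> (\<Sum>w\<in>{w\<in>\<Omega>. lam w = l}. f w)"
      using assms by (intro sum_nonneg) auto
    ultimately show ?thesis unfolding cell_avg_def by (auto simp: divide_le_eq_1)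
  qed
  then have "(cell_avg \<Omega> lam f (lam w))\<^sup>2 \<le> 1" for w
    by (simp add: power_le_one)
  then have "energy \<Omega> lam f \<le> (\<Sum>w\<in>\<Omega>. 1)"
    unfolding energy_def by (intro sum_mono) auto
  then show ?thesis by simp
qed

lemma sum_indicator_card:
  assumes "finite A"
  shows "(\<Sum>w\<in>A. indicator B w) = real (card (B \<inter> A))"
  using assms by (simp add: indicator_def of_bool_def sum.If_cases Int_def conj_commute)

text \<open>
  Pythagoras for the two conditional averages, combined with the pointwise bound
  \<open>t\<^sup>2 \<ge> - 2 \<beta> t - \<beta>\<^sup>2\<close> on \<open>Z\<close>.
\<close>
lemma energy_refine:
  fixes f :: "'a \<Rightarrow> real"
  assumes fin: "finite \<Omega>" and ref: "\<And>w. w \<in> \<Omega> \<Longrightarrow> lam w = th (lam' w)"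
    and Z: "\<And>w. w \<in> Z \<longleftrightarrow> w \<in> \<Omega> \<and> P (lam' w)" and "\<beta> \<ge> 0"
    and low: "(\<Sum>w\<in>Z. f w) \<le> (\<Sum>w\<in>Z. cell_avg \<Omega> lam f (lam w)) - \<beta> * real (card Z)"
  shows "energy \<Omega> lam' f \<ge> energy \<Omega> lam f + \<beta>\<^sup>2 * real (card Z)"
proof -
  define c where "c w = cell_avg \<Omega> lam f (lam w)" for w
  define c' where "c' w = cell_avg \<Omega> lam' f (lam' w)" for w
  have ZO: "Z \<subseteq> \<Omega>" "finite Z" using Z fin by (auto intro: finite_subset)
  have cth: "c w = cell_avg \<Omega> lam f (th (lam' w))" if "w \<in> \<Omega>" for w
    using ref that by (simp add: c_def)
  \<comment> \<open>The coarse average \<open>c\<close> is a function of the fine label, because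
    \<open>lam\<close> factors through \<open>lam'\<close> on \<open>\<Omega>\<close>.\<close>
  have 1: "(\<Sum>w\<in>\<Omega>. c' w * c w) = (\<Sum>w\<in>\<Omega>. f w * c w)"
    using sum_cell_avg[OF fin, of lam' f "\<lambda>l. cell_avg \<Omega> lam f (th l)"]
    by (simp add: c'_def cth cong: sum.cong)
  have 2: "(\<Sum>w\<in>\<Omega>. c w * c w) = (\<Sum>w\<in>\<Omega>. f w * c w)"
    using sum_cell_avg[OF fin, of lam f "\<lambda>l. cell_avg \<Omega> lam f l"] by (simp add: c_def)
  have pyth: "(\<Sum>w\<in>\<Omega>. (c' w - c w)\<^sup>2) = energy \<Omega> lam' f - energy \<Omega> lam f"
  proof -
    have "(\<Sum>w\<in>\<Omega>. (c' w - c w)\<^sup>2)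
        = (\<Sum>w\<in>\<Omega>. (c' w)\<^sup>2) - 2 * (\<Sum>w\<in>\<Omega>. c' w * c w) + (\<Sum>w\<in>\<Omega>. c w * c w)"
      by (simp add: power2_eq_square algebra_simps sum.distrib sum_subtractf sum_distrib_left)
    then show ?thesis
      using 1 2 by (simp add: energy_def c_def c'_def power2_eq_square)
  qed
  have ZF: "(\<Sum>w\<in>Z. g w) = (\<Sum>w\<in>\<Omega>. g w * (if P (lam' w) then 1 else 0))" for g :: "'a \<Rightarrow> real"
  proof -
    have "Z = {w\<in>\<Omega>. P (lam' w)}" using Z by auto
    then show ?thesis using fin by (simp add: sum.If_cases if_distrib Int_def cong: if_cong)
  qed
  \<comment> \<open>\<open>Z\<close> is a union of fine cells, so averaging over them preserves the
    sum over \<open>Z\<close>.\<close>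
  have "(\<Sum>w\<in>Z. c' w) = (\<Sum>w\<in>Z. f w)"
    using sum_cell_avg[OF fin, of lam' f "\<lambda>l. if P l then 1 else 0"] by (simp only: ZF c'_def)
  then have 3: "(\<Sum>w\<in>Z. c' w - c w) \<le> - \<beta> * real (card Z)"
    using low by (simp add: sum_subtractf c_def)
  have "(\<Sum>w\<in>Z. - 2 * \<beta> * (c' w - c w) - \<beta>\<^sup>2) \<le> (\<Sum>w\<in>Z. (c' w - c w)\<^sup>2)"
  proof (rule sum_mono)
    fix w
    have "0 \<le> (c' w - c w + \<beta>)\<^sup>2" by simp
    then show "- 2 * \<beta> * (c' w - c w) - \<beta>\<^sup>2 \<le> (c' w - c w)\<^sup>2"
      by (simp add: power2_eq_square algebra_simps)
  qed
  also have "\<dots> \<le> (\<Sum>w\<in>\<Omega>. (c' w - c w)\<^sup>2)"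
    using ZO fin by (intro sum_mono2) auto
  also have "(\<Sum>w\<in>Z. - 2 * \<beta> * (c' w - c w) - \<beta>\<^sup>2)
      = 2 * \<beta> * (- (\<Sum>w\<in>Z. c' w - c w)) - \<beta>\<^sup>2 * real (card Z)"
  proof -
    have "(\<Sum>w\<in>Z. - 2 * \<beta> * (c' w - c w)) = - 2 * \<beta> * (\<Sum>w\<in>Z. c' w - c w)"
      by (rule sum_distrib_left[symmetric])
    then show ?thesis by (simp only: sum_subtractf sum_constant) (simp add: algebra_simps)
  qed
  finally have "2 * \<beta> * (- (\<Sum>w\<in>Z. c' w - c w)) - \<beta>\<^sup>2 * real (card Z)
      \<le> energy \<Omega> lam' f - energy \<Omega> lam f"
    using pyth by simp
  moreover have "2 * \<beta> * (- (\<Sum>w\<in>Z. c' w - c w)) \<ge> 2 * \<beta> * (\<beta> * real (card Z))"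
    using 3 \<open>\<beta> \<ge> 0\<close> by (intro mult_left_mono) auto
  ultimately show ?thesis by (simp add: power2_eq_square)
qed

text \<open>A sparse cell holds less of \<open>U\<close> than \<open>\<epsilon>\<close> times its
  own size, and the cells are disjoint. This discards edges lying where a colour, or the graph
  itself, is too thin.\<close>

lemma card_sparse_cells:
  assumes "finite X" "U \<subseteq> X" "\<epsilon> \<ge> 0"
  shows "real (card {x\<in>U. real (card {y\<in>U. lam y = lam x}) < \<epsilon> * real (card {y\<in>X. lam y = lam x})})
         \<le> \<epsilon> * real (card X)"
proof -
  define W where "W = {x\<in>U. real (card {y\<in>U. lam y = lam x}) < \<epsilon> * real (card {y\<in>X. lam y = lam x})}"
  have fU: "finite U" using assms finite_subset by blast
  then have fW: "finite W" unfolding W_def by simp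
  have "real (card W) = (\<Sum>l\<in>lam ` W. real (card {x\<in>W. lam x = l}))"
    using sum.image_gen[OF fW, of "\<lambda>_. 1::real" lam] by simp
  also have "\<dots> \<le> (\<Sum>l\<in>lam ` W. \<epsilon> * real (card {x\<in>X. lam x = l}))"
  proof (rule sum_mono)
    fix l assume "l \<in> lam ` W"
    then obtain x where x: "x \<in> W" "l = lam x" by auto
    have "card {x\<in>W. lam x = l} \<le> card {x\<in>U. lam x = l}"
      using fU by (intro card_mono) (auto simp: W_def)
    then show "real (card {x\<in>W. lam x = l}) \<le> \<epsilon> * real (card {x\<in>X. lam x = l})"
      using x unfolding W_def by (simp; linarith)
  qed
  also have "\<dots> \<le> (\<Sum>l\<in>lam ` X. \<epsilon> * real (card {x\<in>X. lam x = l}))"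
    using assms by (intro sum_mono2) (auto simp: W_def)
  also have "\<dots> = \<epsilon> * real (card X)"
    using sum.image_gen[OF assms(1), of "\<lambda>_. \<epsilon>" lam] by (simp add: mult.commute)
  finally show ?thesis unfolding W_def .
qed

text \<open>All colour classes are induced matchings.\<close>
definition induced_colouring :: "nat \<Rightarrow> (nat \<times> nat) set \<Rightarrow> (nat \<times> nat \<Rightarrow> 'c) \<Rightarrow> bool" where
  "induced_colouring n E F \<longleftrightarrow> E \<subseteq> {..<n} \<times> {..<n} \<and>
     (\<forall>x y y'. (x, y) \<in> E \<longrightarrow> (x, y') \<in> E \<longrightarrow> F (x, y) = F (x, y') \<longrightarrow> y = y') \<and>
     (\<forall>x x' y. (x, y) \<in> E \<longrightarrow> (x', y) \<in> E \<longrightarrow> F (x, y) = F (x', y) \<longrightarrow> x = x') \<and>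
     (\<forall>x x' y y'. (x, y) \<in> E \<longrightarrow> (x, y') \<in> E \<longrightarrow> (x', y) \<in> E \<longrightarrow> F (x, y') = F (x', y) \<longrightarrow> x = x')"

text \<open>Label of the atom of \<open>x\<close> in the partition generated by \<open>R\<close>.
  Refining then means adding generators, and \<open>k\<close> generators give at most
  \<open>2 ^ k\<close> atoms.\<close>

definition trace_of :: "'a set set \<Rightarrow> 'a \<Rightarrow> 'a set set" where
  "trace_of R x = {r\<in>R. x \<in> r}"

definition trace2 :: "'a set set \<Rightarrow> 'b set set \<Rightarrow> 'a \<times> 'b \<Rightarrow> 'a set set \<times> 'b set set" where
  "trace2 R C w = (trace_of R (fst w), trace_of C (snd w))"

lemma card_cell2:
  "card {w\<in>X \<times> Y. trace2 R C w = (i, j)} = card {x\<in>X. trace_of R x = i} * card {y\<in>Y. trace_of C y = j}"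
proof -
  have "{w\<in>X \<times> Y. trace2 R C w = (i, j)} = {x\<in>X. trace_of R x = i} \<times> {y\<in>Y. trace_of C y = j}"
    by (auto simp: trace2_def)
  then show ?thesis by (simp add: card_cartesian_product)
qed

text \<open>After cleaning, the product cells of density at least \<open>c / 8\<close> that contain
  an edge whose colour occupies a proportion \<open>\<epsilon>\<close> of their rows and of their
  columns cover at least \<open>c / 2 * n\<^sup>2\<close> pairs. Those rows and columns span a
  rectangle with at most \<open>n\<close> edges, which \<open>large\<close> makes negligible over
  all \<open>4 ^ K\<close> cells. Adding the row set and the column set of one such colour per cell
  to the generators splits off a part \<open>Z\<close> of density at most
  \<open>c / 16\<close>.\<close>

lemma energy_increment:
  fixes c D :: real and n K :: nat
  defines "\<epsilon> \<equiv> c / (8 * D)"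
  assumes cD: "c > 0" "D > 0" and ind: "induced_colouring n E F"
    and colours: "real (card (F ` E)) \<le> D * real n" and dense: "real (card E) \<ge> c * (real n)\<^sup>2"
    and R: "finite R" "card R \<le> K" and C: "finite C" "card C \<le> K"
    and large: "4 ^ K * real n \<le> c / 16 * (\<epsilon>\<^sup>2 * (c / 2)) * (real n)\<^sup>2"
  shows "\<exists>R' C'. finite R' \<and> finite C' \<and> card R' \<le> K + 4 ^ K \<and> card C' \<le> K + 4 ^ K \<and>
    energy ({..<n} \<times> {..<n}) (trace2 R' C') (indicator E)
      \<ge> energy ({..<n} \<times> {..<n}) (trace2 R C) (indicator E) + (c / 16)\<^sup>2 * (\<epsilon>\<^sup>2 * (c / 2)) * (real n)\<^sup>2"
proof -
  define \<Omega> where "\<Omega> = {..<n} \<times> {..<n}"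
  define Us where "Us s = {x. \<exists>y. (x, y) \<in> E \<and> F (x, y) = s}" for s
  define Vs where "Vs s = {y. \<exists>x. (x, y) \<in> E \<and> F (x, y) = s}" for s
  define A where "A i = {x\<in>{..<n}. trace_of R x = i}" for i
  define B where "B j = {y\<in>{..<n}. trace_of C y = j}" for j
  have eps: "\<epsilon> > 0" using cD by (simp add: \<epsilon>_def)
  have EO: "E \<subseteq> \<Omega>" using ind by (simp add: induced_colouring_def \<Omega>_def)
  have finO: "finite \<Omega>" by (simp add: \<Omega>_def)
  have finE: "finite E" using EO finO finite_subset by blast
  have row: "y = y'" if "(x, y) \<in> E" "(x, y') \<in> E" "F (x, y) = F (x, y')" for x y y'
    using ind that unfolding induced_colouring_def by blast
  have col: "x = x'" if "(x, y) \<in> E" "(x', y) \<in> E" "F (x, y) = F (x', y)" for x x' y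
    using ind that unfolding induced_colouring_def by blast
  \<comment> \<open>The edge \<open>(x, y)\<close> joins two edges of colour \<open>s\<close>;
    inducedness makes these coincide, so \<open>(x, y)\<close> is itself that edge.\<close>
  have indm: "F (x, y) = s" if xy: "(x, y) \<in> E" and xs: "x \<in> Us s" and ys: "y \<in> Vs s" for x y s
  proof -
    obtain y' x' where e: "(x, y') \<in> E" "F (x, y') = s" "(x', y) \<in> E" "F (x', y) = s"
      using xs ys unfolding Us_def Vs_def by blast
    then have "x = x'" using ind xy unfolding induced_colouring_def by metis
    then show ?thesis using e by simp
  qed
  have Usn: "Us s \<subseteq> {..<n}" and Vsn: "Vs s \<subseteq> {..<n}" for s
    using EO by (auto simp: Us_def Vs_def \<Omega>_def)
  define bad1 where "bad1 = {w\<in>E. real (card {x\<in>Us (F w). trace_of R x = trace_of R (fst w)})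
      < \<epsilon> * real (card {x\<in>{..<n}. trace_of R x = trace_of R (fst w)})}"
  define bad2 where "bad2 = {w\<in>E. real (card {y\<in>Vs (F w). trace_of C y = trace_of C (snd w)})
      < \<epsilon> * real (card {y\<in>{..<n}. trace_of C y = trace_of C (snd w)})}"
  define bad3 where "bad3 = {w\<in>E. real (card {v\<in>E. trace2 R C v = trace2 R C w})
      < c / 8 * real (card {v\<in>\<Omega>. trace2 R C v = trace2 R C w})}"
  \<comment> \<open>Since colour classes are matchings, each loses at most
    \<open>\<epsilon> * n\<close> edges to sparse cells. With at most \<open>D * n\<close> colours,
    \<open>\<epsilon> = c / (8 * D)\<close> keeps the total below \<open>c / 8 * n\<^sup>2\<close>,
    and three such losses leave at least \<open>c / 2 * n\<^sup>2\<close> edges.\<close>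
  have sum_colours: "real (card W) \<le> D * real n * (\<epsilon> * real n)"
    if "W \<subseteq> E" "\<And>s. real (card {w\<in>W. F w = s}) \<le> \<epsilon> * real n" for W
  proof -
    have fW: "finite W" using that finE finite_subset by blast
    have "real (card W) = (\<Sum>s\<in>F ` W. real (card {w\<in>W. F w = s}))"
      using sum.image_gen[OF fW, of "\<lambda>_. 1::real" F] by simp
    also have "\<dots> \<le> real (card (F ` W)) * (\<epsilon> * real n)"
      using that sum_mono[of "F ` W" "\<lambda>s. real (card {w\<in>W. F w = s})" "\<lambda>_. \<epsilon> * real n"] by simp
    also have "\<dots> \<le> D * real n * (\<epsilon> * real n)"
    proof (rule mult_right_mono)
      have "card (F ` W) \<le> card (F ` E)" using that finE by (intro card_mono) auto
      then show "real (card (F ` W)) \<le> D * real n" using colours by linarith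
    qed (use eps in auto)
    finally show ?thesis .
  qed
  have Deps: "D * real n * (\<epsilon> * real n) = c / 8 * (real n)\<^sup>2"
    using cD by (simp add: \<epsilon>_def power2_eq_square field_simps)
  have b1: "real (card bad1) \<le> c / 8 * (real n)\<^sup>2"
  proof -
    have "real (card {w\<in>bad1. F w = s}) \<le> \<epsilon> * real n" for s
    proof -
      let ?X = "{x\<in>Us s. real (card {y\<in>Us s. trace_of R y = trace_of R x})
          < \<epsilon> * real (card {y\<in>{..<n}. trace_of R y = trace_of R x})}"
      have "card {w\<in>bad1. F w = s} \<le> card ?X"
      proof (rule card_inj_on_le[where f = fst])
        show "inj_on fst {w\<in>bad1. F w = s}"
          using row unfolding inj_on_def bad1_def by fastforce
        show "fst ` {w\<in>bad1. F w = s} \<subseteq> ?X"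
          unfolding bad1_def Us_def by auto
        show "finite ?X" using Usn[of s] finite_subset by fastforce
      qed
      moreover have "real (card ?X) \<le> \<epsilon> * real n"
        using card_sparse_cells[of "{..<n}" "Us s" \<epsilon> "trace_of R"] Usn[of s] eps by simp
      ultimately show ?thesis by linarith
    qed
    then show ?thesis using sum_colours[of bad1] Deps by (auto simp: bad1_def)
  qed
  have b2: "real (card bad2) \<le> c / 8 * (real n)\<^sup>2"
  proof -
    have "real (card {w\<in>bad2. F w = s}) \<le> \<epsilon> * real n" for s
    proof -
      let ?X = "{x\<in>Vs s. real (card {y\<in>Vs s. trace_of C y = trace_of C x})
          < \<epsilon> * real (card {y\<in>{..<n}. trace_of C y = trace_of C x})}"
      have "card {w\<in>bad2. F w = s} \<le> card ?X"
      proof (rule card_inj_on_le[where f = snd])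
        show "inj_on snd {w\<in>bad2. F w = s}"
          using col unfolding inj_on_def bad2_def by fastforce
        show "snd ` {w\<in>bad2. F w = s} \<subseteq> ?X"
          unfolding bad2_def Vs_def by auto
        show "finite ?X" using Vsn[of s] finite_subset by fastforce
      qed
      moreover have "real (card ?X) \<le> \<epsilon> * real n"
        using card_sparse_cells[of "{..<n}" "Vs s" \<epsilon> "trace_of C"] Vsn[of s] eps by simp
      ultimately show ?thesis by linarith
    qed
    then show ?thesis using sum_colours[of bad2] Deps by (auto simp: bad2_def)
  qed
  have b3: "real (card bad3) \<le> c / 8 * (real n)\<^sup>2"
    using card_sparse_cells[of \<Omega> E "c / 8" "trace2 R C"] EO finO cD
    by (simp add: bad3_def \<Omega>_def power2_eq_square)
  define good where "good = E - (bad1 \<union> bad2 \<union> bad3)"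
  have good_card: "real (card good) \<ge> c / 2 * (real n)\<^sup>2"
  proof -
    have "E \<subseteq> good \<union> (bad1 \<union> bad2 \<union> bad3)" by (auto simp: good_def)
    moreover have "finite (good \<union> (bad1 \<union> bad2 \<union> bad3))"
      using finE by (simp add: good_def bad1_def bad2_def bad3_def)
    ultimately have "card E \<le> card (good \<union> (bad1 \<union> bad2 \<union> bad3))" by (rule card_mono[rotated])
    also have "\<dots> \<le> card good + (card bad1 + card bad2 + card bad3)"
      by (meson add_mono card_Un_le le_refl order_trans)
    finally have "real (card E) \<le> real (card good) + (real (card bad1) + real (card bad2) + real (card bad3))"
      by linarith
    moreover have "c * (real n)\<^sup>2 \<ge> 0" using cD by simp
    ultimately show ?thesis using b1 b2 b3 dense by linarith
  qed
  define G where "G = trace2 R C ` good"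
  \<comment> \<open>One good edge per cell selects one colour per cell, so each side receives at
    most \<open>4 ^ K\<close> new generators.\<close>
  define pick where "pick g = (SOME w. w \<in> good \<and> trace2 R C w = g)" for g
  have pick: "pick g \<in> good" "trace2 R C (pick g) = g" if "g \<in> G" for g
  proof -
    have "\<exists>w. w \<in> good \<and> trace2 R C w = g" using that by (auto simp: G_def)
    from someI_ex[OF this] show "pick g \<in> good" "trace2 R C (pick g) = g" by (auto simp: pick_def)
  qed
  define s where "s g = F (pick g)" for g
  have GP: "G \<subseteq> Pow R \<times> Pow C" by (auto simp: G_def trace2_def trace_of_def)
  have finG: "finite G" using GP R C by (meson finite_Pow_iff finite_SigmaI finite_subset)
  have cardG: "card G \<le> 4 ^ K"
  proof -
    have "card G \<le> card (Pow R \<times> Pow C)" using GP R C by (intro card_mono) auto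
    also have "\<dots> = 2 ^ card R * 2 ^ card C"
      using R C by (simp add: card_cartesian_product card_Pow)
    also have "\<dots> \<le> 2 ^ K * 2 ^ K" using R C by (intro mult_mono power_increasing) auto
    also have "\<dots> = (4::nat) ^ K" by (simp flip: power_mult_distrib)
    finally show ?thesis .
  qed
  define R' where "R' = R \<union> (\<lambda>g. Us (s g)) ` G"
  define C' where "C' = C \<union> (\<lambda>g. Vs (s g)) ` G"
  have R': "finite R'" "card R' \<le> K + 4 ^ K"
  proof -
    show "finite R'" using R finG by (simp add: R'_def)
    have "card R' \<le> card R + card ((\<lambda>g. Us (s g)) ` G)" unfolding R'_def by (rule card_Un_le)
    then show "card R' \<le> K + 4 ^ K"
      using card_image_le[OF finG, of "\<lambda>g. Us (s g)"] R cardG by linarith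
  qed
  have C': "finite C'" "card C' \<le> K + 4 ^ K"
  proof -
    show "finite C'" using C finG by (simp add: C'_def)
    have "card C' \<le> card C + card ((\<lambda>g. Vs (s g)) ` G)" unfolding C'_def by (rule card_Un_le)
    then show "card C' \<le> K + 4 ^ K"
      using card_image_le[OF finG, of "\<lambda>g. Vs (s g)"] C cardG by linarith
  qed
  define th where "th l = (fst l \<inter> R, snd l \<inter> C)" for l :: "nat set set \<times> nat set set"
  have th: "trace2 R C w = th (trace2 R' C' w)" for w
    by (auto simp: th_def trace2_def trace_of_def R'_def C'_def)
  \<comment> \<open>Membership in the rectangle chosen for a cell can be read off the refined label,
    as \<open>energy_refine\<close> requires of \<open>Z\<close>.\<close>
  define P where "P l \<longleftrightarrow> th l \<in> G \<and> Us (s (th l)) \<in> fst l \<and> Vs (s (th l)) \<in> snd l" for l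
  define Z where "Z = {w\<in>\<Omega>. P (trace2 R' C' w)}"
  have Zi: "w \<in> Z \<longleftrightarrow> w \<in> \<Omega> \<and> trace2 R C w \<in> G \<and> fst w \<in> Us (s (trace2 R C w)) \<and>
       snd w \<in> Vs (s (trace2 R C w))" for w
  proof -
    have "P (trace2 R' C' w) \<longleftrightarrow> trace2 R C w \<in> G \<and> fst w \<in> Us (s (trace2 R C w)) \<and>
       snd w \<in> Vs (s (trace2 R C w))"
      unfolding P_def th[symmetric] by (auto simp: trace2_def trace_of_def R'_def C'_def)
    then show ?thesis by (simp add: Z_def)
  qed
  have finZ: "finite Z" using finO by (simp add: Z_def)
  have cellZ: "real (card {w\<in>Z. trace2 R C w = g}) \<ge> \<epsilon>\<^sup>2 * real (card {w\<in>\<Omega>. trace2 R C w = g})"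
    if g: "g \<in> G" for g
  proof -
    obtain i j where ij: "g = (i, j)" by (cases g)
    let ?w = "pick g"
    have w: "?w \<in> good" "trace_of R (fst ?w) = i" "trace_of C (snd ?w) = j"
      using pick[OF g] ij by (auto simp: trace2_def)
    have e1: "real (card {x\<in>Us (s g). trace_of R x = i}) \<ge> \<epsilon> * real (card {x\<in>{..<n}. trace_of R x = i})"
      using w unfolding good_def bad1_def s_def by auto
    have e2: "real (card {y\<in>Vs (s g). trace_of C y = j}) \<ge> \<epsilon> * real (card {y\<in>{..<n}. trace_of C y = j})"
      using w unfolding good_def bad2_def s_def by auto
    have "{w\<in>Z. trace2 R C w = g} = {w\<in>Us (s g) \<times> Vs (s g). trace2 R C w = (i, j)}"
      using Usn[of "s g"] Vsn[of "s g"] g ij by (auto simp: Zi \<Omega>_def)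
    then have "real (card {w\<in>Z. trace2 R C w = g})
        = real (card {x\<in>Us (s g). trace_of R x = i}) * real (card {y\<in>Vs (s g). trace_of C y = j})"
      by (simp add: card_cell2)
    also have "\<dots> \<ge> (\<epsilon> * real (card {x\<in>{..<n}. trace_of R x = i})) *
        (\<epsilon> * real (card {y\<in>{..<n}. trace_of C y = j}))"
      using e1 e2 eps by (intro mult_mono) auto
    finally show ?thesis
      using ij card_cell2[of "{..<n}" "{..<n}" R C i j] by (simp add: \<Omega>_def power2_eq_square algebra_simps)
  qed
  have Zcard: "real (card Z) \<ge> \<epsilon>\<^sup>2 * (c / 2) * (real n)\<^sup>2"
  proof -
    have imZ: "trace2 R C ` Z \<subseteq> G" by (auto simp: Zi)
    have "real (card good) = (\<Sum>g\<in>G. real (card {w\<in>good. trace2 R C w = g}))"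
      using sum.image_gen[of good "\<lambda>_. 1::real" "trace2 R C"] finE by (simp add: G_def good_def)
    also have "\<dots> \<le> (\<Sum>g\<in>G. real (card {w\<in>\<Omega>. trace2 R C w = g}))"
    proof (rule sum_mono)
      fix g
      have "{w\<in>good. trace2 R C w = g} \<subseteq> {w\<in>\<Omega>. trace2 R C w = g}" using EO by (auto simp: good_def)
      then show "real (card {w\<in>good. trace2 R C w = g}) \<le> real (card {w\<in>\<Omega>. trace2 R C w = g})"
        using finO by (simp add: card_mono)
    qed
    finally have "\<epsilon>\<^sup>2 * real (card good) \<le> (\<Sum>g\<in>G. \<epsilon>\<^sup>2 * real (card {w\<in>\<Omega>. trace2 R C w = g}))"
      by (simp add: mult_left_mono flip: sum_distrib_left)
    also have "\<dots> \<le> (\<Sum>g\<in>G. real (card {w\<in>Z. trace2 R C w = g}))"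
      using cellZ by (intro sum_mono)
    also have "\<dots> = real (card Z)"
      using sum.group[OF finZ finG imZ, of "\<lambda>_. 1::real"] by simp
    finally have "\<epsilon>\<^sup>2 * real (card good) \<le> real (card Z)" .
    moreover have "\<epsilon>\<^sup>2 * (c / 2 * (real n)\<^sup>2) \<le> \<epsilon>\<^sup>2 * real (card good)"
      using good_card by (intro mult_left_mono) auto
    ultimately show ?thesis by (simp add: mult.assoc)
  qed
  have EZ: "real (card (E \<inter> Z)) \<le> c / 16 * real (card Z)"
  proof -
    have im: "trace2 R C ` (E \<inter> Z) \<subseteq> G" by (auto simp: Zi)
    have "card {w\<in>E \<inter> Z. trace2 R C w = g} \<le> n" for g
    proof -
      let ?X = "{w\<in>E \<inter> Z. trace2 R C w = g}"
      have F: "F w = s g" if "w \<in> ?X" for w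
        using that indm[of "fst w" "snd w" "s g"] by (auto simp: Zi)
      have "card ?X \<le> card {..<n}"
      proof (rule card_inj_on_le[where f = fst])
        show "inj_on fst ?X"
        proof (rule inj_onI)
          fix w v assume wv: "w \<in> ?X" "v \<in> ?X" "fst w = fst v"
          then have "F w = F v" using F by metis
          moreover have "w = (fst w, snd w)" "v = (fst w, snd v)" using wv(3) by (simp_all add: prod_eq_iff)
          ultimately have "snd w = snd v"
            using wv(1,2) row[of "fst w" "snd w" "snd v"] by (metis Int_iff mem_Collect_eq)
          then show "w = v" using wv(3) by (simp add: prod_eq_iff)
        qed
      qed (use EO in \<open>auto simp: \<Omega>_def\<close>)
      then show ?thesis by simp
    qed
    then have "(\<Sum>g\<in>G. card {w\<in>E \<inter> Z. trace2 R C w = g}) \<le> card G * n"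
      using sum_bounded_above[of G "\<lambda>g. card {w\<in>E \<inter> Z. trace2 R C w = g}" n] by simp
    moreover have "(\<Sum>g\<in>G. card {w\<in>E \<inter> Z. trace2 R C w = g}) = card (E \<inter> Z)"
      using sum.group[OF _ finG im, of "\<lambda>_. 1::nat"] finE by simp
    ultimately have "card (E \<inter> Z) \<le> 4 ^ K * n" using cardG by (metis mult_le_mono1 order_trans)
    then have "real (card (E \<inter> Z)) \<le> 4 ^ K * real n"
      by (metis of_nat_le_iff of_nat_mult of_nat_numeral of_nat_power)
    also have "\<dots> \<le> c / 16 * (\<epsilon>\<^sup>2 * (c / 2) * (real n)\<^sup>2)" using large by (simp add: mult.assoc)
    also have "\<dots> \<le> c / 16 * real (card Z)" using Zcard cD by (intro mult_left_mono) auto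
    finally show ?thesis .
  qed
  \<comment> \<open>The cell of \<open>w\<close> contains a good edge, hence one outside
    \<open>bad3\<close>. The density \<open>c / 8\<close> here against \<open>c / 16\<close> on
    \<open>Z\<close> is the gap fed into \<open>energy_refine\<close>.\<close>
  have avg: "cell_avg \<Omega> (trace2 R C) (indicator E) (trace2 R C w) \<ge> c / 8" if "w \<in> Z" for w
  proof -
    define g where "g = trace2 R C w"
    have g: "g \<in> G" "w \<in> \<Omega>" using that by (auto simp: Zi g_def)
    let ?X = "{v\<in>\<Omega>. trace2 R C v = g}"
    have "(\<Sum>v\<in>?X. indicator E v) = (real (card (E \<inter> ?X)))"
      using finO by (intro sum_indicator_card) simp
    moreover have "E \<inter> ?X = {v\<in>E. trace2 R C v = g}" using EO by auto
    moreover have "real (card {v\<in>E. trace2 R C v = g}) \<ge> c / 8 * real (card ?X)"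
      using pick[OF g(1)] unfolding good_def bad3_def by auto
    moreover have "card ?X > 0"
    proof -
      have "w \<in> ?X" using g by (simp add: g_def)
      moreover have "finite ?X" using finO by simp
      ultimately show ?thesis by (metis card_gt_0_iff empty_iff)
    qed
    ultimately show ?thesis by (simp add: cell_avg_def g_def[symmetric] field_simps)
  qed
  have "(\<Sum>w\<in>Z. indicator E w) = real (card (E \<inter> Z))"
    using finZ by (rule sum_indicator_card)
  moreover have "(\<Sum>w\<in>Z. cell_avg \<Omega> (trace2 R C) (indicator E) (trace2 R C w)) \<ge> c / 8 * real (card Z)"
    using sum_mono[of Z "\<lambda>_. c / 8", OF avg] by (simp add: mult.commute)
  ultimately have low: "(\<Sum>w\<in>Z. indicator E w)
      \<le> (\<Sum>w\<in>Z. cell_avg \<Omega> (trace2 R C) (indicator E) (trace2 R C w)) - c / 16 * real (card Z)"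
    using EZ by linarith
  have "energy \<Omega> (trace2 R' C') (indicator E)
      \<ge> energy \<Omega> (trace2 R C) (indicator E) + (c / 16)\<^sup>2 * real (card Z)"
    by (rule energy_refine[where th = th and Z = Z and P = P]) (use finO th low cD in \<open>auto simp: Z_def\<close>)
  moreover have "(c / 16)\<^sup>2 * real (card Z) \<ge> (c / 16)\<^sup>2 * (\<epsilon>\<^sup>2 * (c / 2) * (real n)\<^sup>2)"
    using Zcard by (intro mult_left_mono) auto
  ultimately have "energy \<Omega> (trace2 R' C') (indicator E)
      \<ge> energy \<Omega> (trace2 R C) (indicator E) + (c / 16)\<^sup>2 * (\<epsilon>\<^sup>2 * (c / 2)) * (real n)\<^sup>2"
    by (simp add: mult.assoc)
  then show ?thesis using R' C' unfolding \<Omega>_def by blast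
qed

text \<open>Iterates \<open>energy_increment\<close> from the trivial partition. For fixed
  \<open>c\<close> and \<open>D\<close> the bound \<open>K\<close> on the generators depends only on
  \<open>t\<close>, so \<open>n0\<close> can be chosen after it, large enough for the hypothesis
  \<open>large\<close> of the next round.\<close>

lemma energy_unbounded:
  fixes c D :: real
  assumes cD: "c > 0" "D > 0"
  shows "\<exists>K n0. \<forall>n\<ge>n0. \<forall>E (F :: nat \<times> nat \<Rightarrow> 'c). induced_colouring n E F \<longrightarrow>
      real (card (F ` E)) \<le> D * real n \<longrightarrow> real (card E) \<ge> c * (real n)\<^sup>2 \<longrightarrow>
      (\<exists>R C. finite R \<and> finite C \<and> card R \<le> K \<and> card C \<le> K \<and>
        energy ({..<n} \<times> {..<n}) (trace2 R C) (indicator E)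
          \<ge> real t * ((c / 16)\<^sup>2 * ((c / (8 * D))\<^sup>2 * (c / 2))) * (real n)\<^sup>2)"
proof (induction t)
  case 0
  have "0 \<le> energy ({..<n} \<times> {..<n}) (trace2 {} {}) (indicator E)" for n and E :: "(nat \<times> nat) set"
    unfolding energy_def by (intro sum_nonneg) auto
  then show ?case by (intro exI[of _ 0]) (auto intro!: exI[of _ "{}"])
next
  case (Suc t)
  define \<kappa> where "\<kappa> = (c / 16)\<^sup>2 * ((c / (8 * D))\<^sup>2 * (c / 2))"
  define \<eta> where "\<eta> = c / 16 * ((c / (8 * D))\<^sup>2 * (c / 2))"
  have \<eta>: "\<eta> > 0" using cD by (simp add: \<eta>_def)
  from Suc.IH obtain K n0 where IH: "\<And>n E F. n \<ge> n0 \<Longrightarrow> induced_colouring n E (F :: nat \<times> nat \<Rightarrow> 'c) \<Longrightarrow>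
      real (card (F ` E)) \<le> D * real n \<Longrightarrow> real (card E) \<ge> c * (real n)\<^sup>2 \<Longrightarrow>
      (\<exists>R C. finite R \<and> finite C \<and> card R \<le> K \<and> card C \<le> K \<and>
        energy ({..<n} \<times> {..<n}) (trace2 R C) (indicator E) \<ge> real t * \<kappa> * (real n)\<^sup>2)"
    unfolding \<kappa>_def by blast
  obtain n1 :: nat where n1: "4 ^ K / \<eta> < real n1" using reals_Archimedean2 by blast
  show ?case
  proof (rule exI[of _ "K + 4 ^ K"], rule exI[of _ "max n0 n1"], intro allI impI)
    fix n E and F :: "nat \<times> nat \<Rightarrow> 'c"
    assume n: "max n0 n1 \<le> n" and h: "induced_colouring n E F"
      "real (card (F ` E)) \<le> D * real n" "real (card E) \<ge> c * (real n)\<^sup>2"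
    obtain R C where RC: "finite R" "finite C" "card R \<le> K" "card C \<le> K"
      "energy ({..<n} \<times> {..<n}) (trace2 R C) (indicator E) \<ge> real t * \<kappa> * (real n)\<^sup>2"
      using IH[OF _ h] n by auto
    have "4 ^ K / \<eta> \<le> real n" using n n1 by linarith
    then have "4 ^ K \<le> \<eta> * real n" using \<eta> by (simp add: field_simps)
    then have "4 ^ K * real n \<le> \<eta> * (real n)\<^sup>2"
      using mult_right_mono[of "4 ^ K" "\<eta> * real n" "real n"] by (simp add: power2_eq_square mult.assoc)
    then obtain R' C' where "finite R'" "finite C'" "card R' \<le> K + 4 ^ K" "card C' \<le> K + 4 ^ K"
      "energy ({..<n} \<times> {..<n}) (trace2 R' C') (indicator E)
        \<ge> energy ({..<n} \<times> {..<n}) (trace2 R C) (indicator E) + \<kappa> * (real n)\<^sup>2"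
      using energy_increment[OF cD h RC(1,3) RC(2,4)] unfolding \<eta>_def \<kappa>_def by (auto simp: mult.assoc)
    with RC show "\<exists>R C. finite R \<and> finite C \<and> card R \<le> K + 4 ^ K \<and> card C \<le> K + 4 ^ K \<and>
        energy ({..<n} \<times> {..<n}) (trace2 R C) (indicator E)
          \<ge> real (Suc t) * ((c / 16)\<^sup>2 * ((c / (8 * D))\<^sup>2 * (c / 2))) * (real n)\<^sup>2"
      unfolding \<kappa>_def[symmetric] by (intro exI[of _ R'] exI[of _ C']) (auto simp: algebra_simps)
  qed
qed

text \<open>The energy never exceeds \<open>n\<^sup>2\<close>, yet a dense induced colouring would
  push it to \<open>t * \<kappa> * n\<^sup>2\<close> for every \<open>t\<close>. This is the
  Ruzsa-Szemeredi theorem in the form that a union of linearly many induced matchings has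
  \<open>o(n\<^sup>2)\<close> edges.\<close>

lemma dense_not_induced:
  fixes c D :: real
  assumes cD: "c > 0" "D > 0"
  shows "\<exists>n0. \<forall>n\<ge>n0. \<forall>E (F :: nat \<times> nat \<Rightarrow> 'c). real (card (F ` E)) \<le> D * real n \<longrightarrow>
      real (card E) \<ge> c * (real n)\<^sup>2 \<longrightarrow> \<not> induced_colouring n E F"
proof -
  define \<kappa> where "\<kappa> = (c / 16)\<^sup>2 * ((c / (8 * D))\<^sup>2 * (c / 2))"
  have \<kappa>: "\<kappa> > 0" using cD by (simp add: \<kappa>_def)
  obtain t :: nat where t: "1 / \<kappa> < real t" using reals_Archimedean2 by blast
  obtain K n0 where *: "\<And>n E F. n \<ge> n0 \<Longrightarrow> induced_colouring n E (F :: nat \<times> nat \<Rightarrow> 'c) \<Longrightarrow>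
      real (card (F ` E)) \<le> D * real n \<Longrightarrow> real (card E) \<ge> c * (real n)\<^sup>2 \<Longrightarrow>
      (\<exists>R C. energy ({..<n} \<times> {..<n}) (trace2 R C) (indicator E) \<ge> real t * \<kappa> * (real n)\<^sup>2)"
    using energy_unbounded[OF cD, of t, where 'c = 'c] unfolding \<kappa>_def by blast
  show ?thesis
  proof (rule exI[of _ "max n0 1"], intro allI impI notI)
    fix n E and F :: "nat \<times> nat \<Rightarrow> 'c"
    assume n: "max n0 1 \<le> n" and h: "real (card (F ` E)) \<le> D * real n"
      "c * (real n)\<^sup>2 \<le> real (card E)" "induced_colouring n E F"
    obtain R C where RC: "energy ({..<n} \<times> {..<n}) (trace2 R C) (indicator E) \<ge> real t * \<kappa> * (real n)\<^sup>2"
      using *[of n E F] n h by auto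
    have "energy ({..<n} \<times> {..<n}) (trace2 R C) (indicator E) \<le> real (card ({..<n} \<times> {..<n}))"
      by (rule energy_le_card) (auto simp: indicator_def)
    then have "real t * \<kappa> * (real n)\<^sup>2 \<le> 1 * (real n)\<^sup>2"
      using RC by (simp add: power2_eq_square)
    then have "real t * \<kappa> \<le> 1" using n by (subst (asm) mult_le_cancel_right_pos) auto
    then show False using t \<kappa> by (simp add: field_simps)
  qed
qed

section \<open>Forced configurations in monotone grids\<close>

text \<open>\<open>f\<close> stands for ranks of slopes. It is monotone on all indices, so that the
  last block may overhang \<open>n\<close>; distinctness within rows and columns is demanded only on
  edges, where the ranks separate slopes.\<close>

definition monotone_grid :: "nat \<Rightarrow> nat \<Rightarrow> (nat \<Rightarrow> nat \<Rightarrow> nat) \<Rightarrow> (nat \<times> nat) set \<Rightarrow> bool" where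
  "monotone_grid n N f E \<longleftrightarrow> E \<subseteq> {..<n} \<times> {..<n} \<and>
     (\<forall>i i' j j'. i \<le> i' \<longrightarrow> j \<le> j' \<longrightarrow> f i j \<le> f i' j') \<and> (\<forall>i j. f i j \<le> N) \<and>
     (\<forall>i i' j. (i, j) \<in> E \<longrightarrow> (i', j) \<in> E \<longrightarrow> f i j = f i' j \<longrightarrow> i = i') \<and>
     (\<forall>i j j'. (i, j) \<in> E \<longrightarrow> (i, j') \<in> E \<longrightarrow> f i j = f i j' \<longrightarrow> j = j')"

text \<open>Other diagonal pairs are left out because the two points of an added index come from
  block pairs that need not form an edge together. The pair \<open>(x 0, y 0)\<close> is kept as the
  content of the case \<open>k = 1\<close> and as the anchor to which later points are
  attached.\<close>

definition symmetric_config :: "nat \<Rightarrow> (nat \<times> nat) set \<Rightarrow> (nat \<Rightarrow> nat \<Rightarrow> nat) \<Rightarrow> (nat \<Rightarrow> nat) \<Rightarrow> (nat \<Rightarrow> nat) \<Rightarrow> bool" where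
  "symmetric_config k E f x y \<longleftrightarrow> inj_on x {..<k} \<and> inj_on y {..<k} \<and> (x 0, y 0) \<in> E \<and>
     (\<forall>i<k. \<forall>j<k. i \<noteq> j \<longrightarrow> (x i, y j) \<in> E \<and> f (x i) (y j) = f (x j) (y i))"

definition config_forced :: "nat \<Rightarrow> bool" where
  "config_forced k \<longleftrightarrow> (\<forall>c>0. \<forall>D>0. \<exists>n0. \<forall>n\<ge>n0. \<forall>N f E. monotone_grid n N f E \<longrightarrow>
     real N \<le> D * real n \<longrightarrow> real (card E) \<ge> c * (real n)\<^sup>2 \<longrightarrow> (\<exists>x y. symmetric_config k E f x y))"

lemma config_forced_1: "config_forced 1"
  unfolding config_forced_def
proof (intro allI impI exI[of _ 1])
  fix c D :: real and n N :: nat and f and E :: "(nat \<times> nat) set"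
  assume "c > 0" and n: "1 \<le> n" and "c * (real n)\<^sup>2 \<le> real (card E)"
  moreover have "c * (real n)\<^sup>2 > 0" using n \<open>c > 0\<close> by simp
  ultimately have "card E \<noteq> 0" by linarith
  then obtain i j where "(i, j) \<in> E" by (metis card.empty ex_in_conv surj_pair)
  then show "\<exists>x y. symmetric_config 1 E f x y"
    by (intro exI[of _ "\<lambda>_. i"] exI[of _ "\<lambda>_. j"]) (auto simp: symmetric_config_def inj_on_def)
qed

section \<open>Recurrence of one pattern in blocks of constant length\<close>

text \<open>A diagonal step is one step in each index. Either kind telescopes along each of
  \<open>U\<close> lines to at most \<open>N\<close>, whence the factor
  \<open>2 * U\<close>.\<close>

lemma sum_diagonal_increments:
  fixes g :: "nat \<Rightarrow> nat \<Rightarrow> nat"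
  assumes "\<And>i j. g i j \<le> N"
  shows "(\<Sum>u<U. \<Sum>v<U. real (g (Suc u) (Suc v)) - real (g u v)) \<le> 2 * real U * real N"
proof -
  have "(\<Sum>u<U. \<Sum>v<U. real (g (Suc u) (Suc v)) - real (g u v))
      = (\<Sum>u<U. \<Sum>v<U. real (g (Suc u) (Suc v)) - real (g u (Suc v)))
        + (\<Sum>u<U. \<Sum>v<U. real (g u (Suc v)) - real (g u v))"
    by (simp flip: sum.distrib)
  also have "(\<Sum>u<U. \<Sum>v<U. real (g (Suc u) (Suc v)) - real (g u (Suc v)))
      = (\<Sum>v<U. real (g U (Suc v)) - real (g 0 (Suc v)))"
    by (subst sum.swap) (simp add: sum_lessThan_telescope[of "\<lambda>u. real (g u _)"])
  also have "\<dots> \<le> (\<Sum>v<U. real N)"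
    using assms by (intro sum_mono) (simp add: add_increasing2 diff_le_eq)
  also have "(\<Sum>u<U. \<Sum>v<U. real (g u (Suc v)) - real (g u v)) = (\<Sum>u<U. real (g u U) - real (g u 0))"
    by (simp add: sum_lessThan_telescope[of "\<lambda>v. real (g _ v)"])
  also have "\<dots> \<le> (\<Sum>u<U. real N)"
    using assms by (intro sum_mono) (simp add: add_increasing2 diff_le_eq)
  finally show ?thesis by (simp add: mult_ac)
qed

lemma pigeonhole_pattern:
  assumes "finite G" "finite Q" "\<And>w. w \<in> G \<Longrightarrow> \<exists>q\<in>Q. P w q" "G \<noteq> {}"
  shows "\<exists>q\<in>Q. real (card {w\<in>G. P w q}) \<ge> real (card G) / real (card Q)"
proof (rule ccontr)
  assume neg: "\<not> ?thesis"
  obtain h where h: "\<And>w. w \<in> G \<Longrightarrow> h w \<in> Q \<and> P w (h w)" using assms(3) by metis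
  have Q: "Q \<noteq> {}" using assms(3,4) by auto
  have "real (card G) = (\<Sum>q\<in>Q. real (card {w\<in>G. h w = q}))"
    using sum.group[OF assms(1,2), of h "\<lambda>_. 1::real"] h by (simp add: image_subset_iff)
  also have "\<dots> \<le> (\<Sum>q\<in>Q. real (card {w\<in>G. P w q}))"
    using h assms(1) by (intro sum_mono) (auto intro!: card_mono)
  also have "\<dots> < (\<Sum>q\<in>Q. real (card G) / real (card Q))"
    using neg Q assms(2) by (intro sum_strict_mono) auto
  also have "\<dots> = real (card G)" using Q assms(2) by simp
  finally show False by simp
qed

text \<open>The offsets \<open>p\<close> from the corner value are common to all of
  \<open>W\<close>. This turns an equality between the corner values of two block pairs into
  equalities at all corresponding positions.\<close>

definition recurrent_config ::
  "nat \<Rightarrow> nat \<Rightarrow> real \<Rightarrow> nat \<Rightarrow> (nat \<times> nat) set \<Rightarrow> (nat \<Rightarrow> nat \<Rightarrow> nat) \<Rightarrow> bool" where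
  "recurrent_config k m \<gamma> U E f \<longleftrightarrow> (\<exists>\<sigma> \<rho> p W. W \<subseteq> {..<U} \<times> {..<U} \<and>
     real (card W) \<ge> \<gamma> * (real U)\<^sup>2 \<and> (\<forall>i<k. \<sigma> i < m \<and> \<rho> i < m) \<and>
     (\<forall>u v. (u, v) \<in> W \<longrightarrow> symmetric_config k E f (\<lambda>i. u * m + \<sigma> i) (\<lambda>j. v * m + \<rho> j) \<and>
        (\<forall>i<k. \<forall>j<k. f (u * m + \<sigma> i) (v * m + \<rho> j) = f (u * m) (v * m) + p (i, j))))"

text \<open>
  Along every diagonal the ranges of \<open>f\<close> on the \<open>m \<times> m\<close> blocks add up to at most \<open>N\<close>, so most
  blocks are again grids with few values, to which the hypothesis applies. As \<open>m\<close> is constant,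
  there are boundedly many patterns, and one of them occurs in a positive proportion of the blocks.
\<close>
lemma popular_pattern:
  assumes forced: "config_forced k" and k0: "k > 0" and cD: "c > 0" "D > 0"
  shows "\<exists>m>0. \<exists>\<gamma>>0. \<exists>n0. (\<forall>n\<ge>n0. \<forall>N f E. monotone_grid n N f E \<longrightarrow> real N \<le> D * real n \<longrightarrow>
     real (card E) \<ge> c * (real n)\<^sup>2 \<longrightarrow>
     recurrent_config k m \<gamma> (n div m + 1) E f)"
proof -
  \<comment> \<open>The ranges over all block pairs add up to at most
    \<open>2 * D * U\<^sup>2 * m\<close>, so by Markov's inequality at most
    \<open>c / 16 * U\<^sup>2\<close> of them exceed \<open>D1 * m\<close>.\<close>
  define D1 where "D1 = 32 * D / c"
  have D1: "D1 > 0" using cD by (simp add: D1_def)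
  obtain m0 where m0: "\<And>n N f E. n \<ge> m0 \<Longrightarrow> monotone_grid n N f E \<Longrightarrow> real N \<le> D1 * real n \<Longrightarrow>
      real (card E) \<ge> c / 16 * (real n)\<^sup>2 \<Longrightarrow> \<exists>x y. symmetric_config k E f x y"
    using forced D1 cD unfolding config_forced_def by (metis divide_pos_pos zero_less_numeral)
  define m where "m = max m0 1"
  have m: "m > 0" "m \<ge> m0" by (auto simp: m_def)
  \<comment> \<open>All conceivable patterns: two lists of positions in a block and a table of
    offsets. The offsets are bounded because only blocks of range at most \<open>D1 * m\<close> are
    used.\<close>
  define Q where "Q = ({..<k} \<rightarrow>\<^sub>E {..<m}) \<times> ({..<k} \<rightarrow>\<^sub>E {..<m}) \<times>
      (({..<k} \<times> {..<k}) \<rightarrow>\<^sub>E {..nat \<lfloor>D1 * real m\<rfloor>})"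
  have Q: "finite Q" by (simp add: Q_def finite_PiE)
  have "(\<lambda>i\<in>{..<k}. 0, \<lambda>i\<in>{..<k}. 0, \<lambda>ij\<in>{..<k} \<times> {..<k}. 0) \<in> Q" using m by (simp add: Q_def)
  then have Q0: "card Q > 0" using Q by (metis card_gt_0_iff empty_iff)
  define \<gamma> where "\<gamma> = c / 8 / real (card Q)"
  have \<gamma>: "\<gamma> > 0" using cD Q0 by (simp add: \<gamma>_def)
  show ?thesis
  proof (intro exI[of _ m] exI[of _ \<gamma>] conjI allI impI)
    fix n N f E
    assume n: "m \<le> n" and sys: "monotone_grid n N f E" and N: "real N \<le> D * real n"
      and dense: "c * (real n)\<^sup>2 \<le> real (card E)"
    \<comment> \<open>The extra block lets the blocks cover \<open>{..<n}\<close>; the overhang only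
      costs \<open>U * m \<le> 2 * n\<close>.\<close>
    define U where "U = n div m + 1"
    have nU: "n \<le> U * m"
      unfolding U_def by (metis add.commute add_mult_distrib dividend_less_times_div less_or_eq_imp_le mult.commute mult_1 m(1))
    have "U * m \<le> n + m" unfolding U_def using m by (simp add: add_mult_distrib)
    then have Un: "U * m \<le> 2 * n" using n by linarith
    have U1: "U \<ge> 1" by (simp add: U_def)
    have EO: "E \<subseteq> {..<n} \<times> {..<n}" and mono: "\<And>i i' j j'. i \<le> i' \<Longrightarrow> j \<le> j' \<Longrightarrow> f i j \<le> f i' j'"
      and fN: "\<And>i j. f i j \<le> N"
      and col: "\<And>i i' j. (i, j) \<in> E \<Longrightarrow> (i', j) \<in> E \<Longrightarrow> f i j = f i' j \<Longrightarrow> i = i'"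
      and row: "\<And>i j j'. (i, j) \<in> E \<Longrightarrow> (i, j') \<in> E \<Longrightarrow> f i j = f i j' \<Longrightarrow> j = j'"
      using sys unfolding monotone_grid_def by blast+
    have finE: "finite E" using EO finite_subset by blast
    define B where "B = {..<U} \<times> {..<U}"
    define Eb where "Eb w = {(i, j). i < m \<and> j < m \<and> (fst w * m + i, snd w * m + j) \<in> E}" for w
    define rg where "rg w = f (fst w * m + (m - 1)) (snd w * m + (m - 1)) - f (fst w * m) (snd w * m)" for w
    have Ebm: "Eb w \<subseteq> {..<m} \<times> {..<m}" for w by (auto simp: Eb_def)
    have card_Eb: "card (Eb w) \<le> m * m" for w
      using card_mono[OF _ Ebm[of w]] by (simp add: card_cartesian_product)
    have finEb: "finite (Eb w)" for w using Ebm finite_subset by blast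
    have sumE: "card E \<le> (\<Sum>w\<in>B. card (Eb w))"
    proof -
      let ?h = "\<lambda>e. (fst e div m, snd e div m)"
      have hB: "?h ` E \<subseteq> B"
      proof -
        have "i div m < U" if "i < n" for i
          using that unfolding U_def by (simp add: div_le_mono le_imp_less_Suc)
        then show ?thesis using EO by (auto simp: B_def)
      qed
      have "card E = (\<Sum>w\<in>B. card {e\<in>E. ?h e = w})"
        using sum.group[OF finE _ hB, of "\<lambda>_. 1::nat"] by (simp add: B_def)
      also have "\<dots> \<le> (\<Sum>w\<in>B. card (Eb w))"
      proof (rule sum_mono)
        fix w
        show "card {e\<in>E. ?h e = w} \<le> card (Eb w)"
        proof (rule card_inj_on_le[where f = "\<lambda>e. (fst e mod m, snd e mod m)"])
          show "inj_on (\<lambda>e. (fst e mod m, snd e mod m)) {e\<in>E. ?h e = w}"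
            by (rule inj_onI) (auto simp: prod_eq_iff, (metis div_mult_mod_eq)+)
          show "(\<lambda>e. (fst e mod m, snd e mod m)) ` {e\<in>E. ?h e = w} \<subseteq> Eb w"
            using m by (auto simp: Eb_def)
        qed (rule finEb)
      qed
      finally show ?thesis .
    qed
    \<comment> \<open>Relative to \<open>(U * m)\<^sup>2\<close> the graph has density at least
      \<open>c / 4\<close>. Sparse blocks take \<open>c / 16\<close> of it and blocks of large range
      another \<open>c / 16\<close>, leaving \<open>c / 8\<close>.\<close>
    define G where "G = {w\<in>B. real (card (Eb w)) \<ge> c / 16 * (real m)\<^sup>2 \<and> real (rg w) \<le> D1 * real m}"
    define X where "X = {w\<in>B. real (rg w) > D1 * real m}"
    have finB: "finite B" by (simp add: B_def)
    have Xcard: "real (card X) \<le> c / 16 * (real U)\<^sup>2"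
    proof -
      have "(\<Sum>w\<in>B. real (rg w)) \<le> (\<Sum>w\<in>B. real (f (Suc (fst w) * m) (Suc (snd w) * m)) - real (f (fst w * m) (snd w * m)))"
      proof (rule sum_mono)
        fix w
        have "f (fst w * m + (m - 1)) (snd w * m + (m - 1)) \<le> f (Suc (fst w) * m) (Suc (snd w) * m)"
          by (rule mono) auto
        moreover have "f (fst w * m) (snd w * m) \<le> f (fst w * m + (m - 1)) (snd w * m + (m - 1))"
          by (rule mono) auto
        ultimately show "real (rg w) \<le> real (f (Suc (fst w) * m) (Suc (snd w) * m)) - real (f (fst w * m) (snd w * m))"
          by (simp add: rg_def of_nat_diff)
      qed
      also have "\<dots> = (\<Sum>u<U. \<Sum>v<U. real (f (Suc u * m) (Suc v * m)) - real (f (u * m) (v * m)))"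
        by (simp add: B_def sum.cartesian_product case_prod_beta)
      also have "\<dots> \<le> 2 * real U * real N"
        using sum_diagonal_increments[of "\<lambda>u v. f (u * m) (v * m)" N U] fN by simp
      also have "\<dots> \<le> 2 * real U * (D * (real U * real m))"
      proof -
        have "real n \<le> real U * real m" using nU by (metis of_nat_le_iff of_nat_mult)
        then have "D * real n \<le> D * (real U * real m)" using cD by simp
        then show ?thesis using N by (intro mult_left_mono) auto
      qed
      finally have 1: "(\<Sum>w\<in>B. real (rg w)) \<le> 2 * D * (real U)\<^sup>2 * real m"
        by (simp add: power2_eq_square algebra_simps)
      have "D1 * real m * real (card X) \<le> (\<Sum>w\<in>X. real (rg w))"
        using sum_mono[of X "\<lambda>_. D1 * real m" "\<lambda>w. real (rg w)"] by (simp add: X_def mult.commute less_imp_le)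
      also have "\<dots> \<le> (\<Sum>w\<in>B. real (rg w))" using finB by (intro sum_mono2) (auto simp: X_def)
      also note 1
      also have "2 * D * (real U)\<^sup>2 * real m = D1 * real m * (c / 16 * (real U)\<^sup>2)"
        using cD by (simp add: D1_def)
      finally have "D1 * real m * real (card X) \<le> D1 * real m * (c / 16 * (real U)\<^sup>2)" .
      then show ?thesis using D1 m by (simp only: mult_le_cancel_left_pos mult_pos_pos of_nat_0_less_iff)
    qed
    have Gcard: "real (card G) \<ge> c / 8 * (real U)\<^sup>2"
    proof -
      have finGX: "finite G" "finite X" using finB by (auto simp: G_def X_def)
      have "real (card E) \<le> (\<Sum>w\<in>B. real (card (Eb w)))"
        using sumE by (metis of_nat_le_iff of_nat_sum)
      also have "\<dots> \<le> (\<Sum>w\<in>B. (real m)\<^sup>2 * indicator G w + (real m)\<^sup>2 * indicator X w + c / 16 * (real m)\<^sup>2)"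
      proof (rule sum_mono)
        fix w assume w: "w \<in> B"
        have aux: "a \<le> M * of_bool p + M * of_bool q + z"
          if "a \<le> M" "0 \<le> z" "0 \<le> a" "p \<or> q \<or> a \<le> z" for a M z :: real and p q
          using that by (cases p; cases q) auto
        have "real (card (Eb w)) \<le> (real m)\<^sup>2"
          using card_Eb[of w] by (metis of_nat_le_iff of_nat_mult power2_eq_square)
        moreover have "0 \<le> c / 16 * (real m)\<^sup>2" using cD by simp
        moreover have "w \<in> G \<or> w \<in> X \<or> real (card (Eb w)) \<le> c / 16 * (real m)\<^sup>2"
          using w by (auto simp: G_def X_def)
        ultimately show "real (card (Eb w)) \<le> (real m)\<^sup>2 * indicator G w + (real m)\<^sup>2 * indicator X w + c / 16 * (real m)\<^sup>2"
          unfolding indicator_def by (intro aux) auto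
      qed
      also have "\<dots> = (real m)\<^sup>2 * real (card G) + (real m)\<^sup>2 * real (card X) + c / 16 * (real m)\<^sup>2 * (real U)\<^sup>2"
      proof -
        have "(\<Sum>w\<in>B. indicator Y w) = real (card Y)" if "Y \<subseteq> B" for Y
          using sum_indicator_card[OF finB, of Y] that by (simp add: Int_absorb2)
        moreover have "G \<subseteq> B" "X \<subseteq> B" by (auto simp: G_def X_def)
        ultimately show ?thesis
          by (simp add: sum.distrib B_def card_cartesian_product power2_eq_square flip: sum_distrib_left)
      qed
      finally have 1: "real (card E) \<le> (real m)\<^sup>2 * (real (card G) + real (card X) + c / 16 * (real U)\<^sup>2)"
        by (simp add: algebra_simps)
      have "real U * real m \<le> 2 * real n" using Un by (metis of_nat_le_iff of_nat_mult of_nat_numeral)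
      then have "(real U * real m)\<^sup>2 \<le> (2 * real n)\<^sup>2" by (intro power_mono) auto
      then have "c / 4 * (real U * real m)\<^sup>2 \<le> c / 4 * (2 * real n)\<^sup>2" using cD by (intro mult_left_mono) auto
      then have "(real m)\<^sup>2 * (c / 4 * (real U)\<^sup>2) \<le> c * (real n)\<^sup>2" by (simp add: power_mult_distrib algebra_simps)
      then have "(real m)\<^sup>2 * (c / 4 * (real U)\<^sup>2) \<le> (real m)\<^sup>2 * (real (card G) + real (card X) + c / 16 * (real U)\<^sup>2)"
        using 1 dense by linarith
      then have "c / 4 * (real U)\<^sup>2 \<le> real (card G) + real (card X) + c / 16 * (real U)\<^sup>2"
        using m by simp
      then show ?thesis using Xcard by simp
    qed
    define P where "P w q \<longleftrightarrow> (case q of (\<sigma>, \<rho>, p) \<Rightarrow>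
        symmetric_config k E f (\<lambda>i. fst w * m + \<sigma> i) (\<lambda>j. snd w * m + \<rho> j) \<and>
        (\<forall>i<k. \<forall>j<k. f (fst w * m + \<sigma> i) (snd w * m + \<rho> j) = f (fst w * m) (snd w * m) + p (i, j)))" for w q
    have ex: "\<exists>q\<in>Q. P w q" if w: "w \<in> G" for w
    proof -
      obtain u v where uv: "w = (u, v)" by (cases w)
      \<comment> \<open>Truncation at \<open>m - 1\<close> keeps the block function monotone and at
        most \<open>rg w\<close> on all indices.\<close>
      define fb where "fb i j = f (u * m + min i (m - 1)) (v * m + min j (m - 1)) - f (u * m) (v * m)" for i j
      have f0: "f (u * m) (v * m) \<le> f (u * m + i) (v * m + j)" for i j by (rule mono) auto
      have fb: "fb i j = f (u * m + i) (v * m + j) - f (u * m) (v * m)" if "i < m" "j < m" for i j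
      proof -
        have "min i (m - 1) = i" "min j (m - 1) = j" using that by auto
        then show ?thesis by (simp add: fb_def)
      qed
      have "monotone_grid m (rg w) fb (Eb w)"
        unfolding monotone_grid_def
      proof (intro conjI allI impI)
        show "Eb w \<subseteq> {..<m} \<times> {..<m}" by (rule Ebm)
        show "fb i j \<le> fb i' j'" if "i \<le> i'" "j \<le> j'" for i i' j j'
          unfolding fb_def using that by (intro diff_le_mono mono) auto
        show "fb i j \<le> rg w" for i j
          unfolding fb_def rg_def uv by (simp, intro diff_le_mono mono) auto
      next
        fix i i' j assume "(i, j) \<in> Eb w" "(i', j) \<in> Eb w" "fb i j = fb i' j"
        moreover from this have "f (u * m + i) (v * m + j) = f (u * m + i') (v * m + j)"
          using f0[of i j] f0[of i' j] by (auto simp: Eb_def fb)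
        ultimately show "i = i'" using col[of "u * m + i" "v * m + j" "u * m + i'"] by (auto simp: Eb_def uv)
      next
        fix i j j' assume "(i, j) \<in> Eb w" "(i, j') \<in> Eb w" "fb i j = fb i j'"
        moreover from this have "f (u * m + i) (v * m + j) = f (u * m + i) (v * m + j')"
          using f0[of i j] f0[of i j'] by (auto simp: Eb_def fb)
        ultimately show "j = j'" using row[of "u * m + i" "v * m + j" "v * m + j'"] by (auto simp: Eb_def uv)
      qed
      then obtain x y where xy: "symmetric_config k (Eb w) fb x y"
        using m0[of m "rg w" fb "Eb w"] m w by (auto simp: G_def)
      have xm: "x i < m \<and> y i < m" if "i < k" for i
      proof (cases "\<exists>j<k. j \<noteq> i")
        case True
        then obtain j where "j < k" "j \<noteq> i" by blast
        then have "(x i, y j) \<in> Eb w" "(x j, y i) \<in> Eb w"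
          using xy \<open>i < k\<close> unfolding symmetric_config_def by metis+
        then show ?thesis using Ebm by blast
      next
        case False
        then have "i = 0" using that by (metis gr_zeroI order.strict_trans)
        then show ?thesis using xy Ebm[of w] unfolding symmetric_config_def by auto
      qed
      define \<sigma> where "\<sigma> = restrict x {..<k}"
      define \<rho> where "\<rho> = restrict y {..<k}"
      define p where "p = (\<lambda>ij\<in>{..<k} \<times> {..<k}. f (u * m + x (fst ij)) (v * m + y (snd ij)) - f (u * m) (v * m))"
      have pb: "f (u * m + i) (v * m + j) - f (u * m) (v * m) \<le> nat \<lfloor>D1 * real m\<rfloor>" if "i < m" "j < m" for i j
      proof -
        have "f (u * m + i) (v * m + j) - f (u * m) (v * m) \<le> rg w"
          unfolding rg_def uv using that by (simp, intro diff_le_mono mono) auto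
        moreover have "real (rg w) \<le> D1 * real m" using w by (simp add: G_def)
        ultimately show ?thesis using le_nat_floor by (meson le_trans)
      qed
      have "(\<sigma>, \<rho>, p) \<in> Q"
        using xm pb unfolding Q_def \<sigma>_def \<rho>_def p_def by auto
      moreover have "P w (\<sigma>, \<rho>, p)"
      proof -
        have eq: "f (u * m + x i) (v * m + y j) = f (u * m + x j) (v * m + y i)"
          if "i < k" "j < k" "i \<noteq> j" for i j
        proof -
          have "fb (x i) (y j) = fb (x j) (y i)" using xy that by (auto simp: symmetric_config_def)
          then show ?thesis using f0[of "x i" "y j"] f0[of "x j" "y i"] xm that by (simp add: fb)
        qed
        have inj: "inj_on x {..<k}" "inj_on y {..<k}" using xy by (auto simp: symmetric_config_def)
        have E0: "(u * m + x 0, v * m + y 0) \<in> E" using xy by (auto simp: symmetric_config_def Eb_def uv)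
        have Eij: "(u * m + x i, v * m + y j) \<in> E" if "i < k" "j < k" "i \<noteq> j" for i j
        proof -
          have "(x i, y j) \<in> Eb w" using xy that unfolding symmetric_config_def by blast
          then show ?thesis by (simp add: Eb_def uv)
        qed
        have "symmetric_config k E f (\<lambda>i. u * m + \<sigma> i) (\<lambda>j. v * m + \<rho> j)"
          unfolding symmetric_config_def
        proof (intro conjI allI impI)
          show "inj_on (\<lambda>i. u * m + \<sigma> i) {..<k}" "inj_on (\<lambda>i. v * m + \<rho> i) {..<k}"
            using inj by (simp_all add: inj_on_def \<sigma>_def \<rho>_def)
          show "(u * m + \<sigma> 0, v * m + \<rho> 0) \<in> E" using E0 k0 by (simp add: \<sigma>_def \<rho>_def)
        next
          fix i j assume "i < k" "j < k" "i \<noteq> j"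
          then show "(u * m + \<sigma> i, v * m + \<rho> j) \<in> E"
            "f (u * m + \<sigma> i) (v * m + \<rho> j) = f (u * m + \<sigma> j) (v * m + \<rho> i)"
            using Eij eq by (simp_all add: \<sigma>_def \<rho>_def)
        qed
        then show ?thesis using f0 by (simp add: P_def uv \<sigma>_def \<rho>_def p_def)
      qed
      ultimately show ?thesis by blast
    qed
    have finG: "finite G" using finB by (simp add: G_def)
    have "0 < c / 8 * (real U)\<^sup>2" using cD U1 by simp
    then have "G \<noteq> {}" using Gcard by auto
    then obtain q where q: "q \<in> Q" "real (card {w\<in>G. P w q}) \<ge> real (card G) / real (card Q)"
      using pigeonhole_pattern[where P = P, OF finG Q ex \<open>G \<noteq> {}\<close>] by blast
    obtain \<sigma> \<rho> p where qe: "q = (\<sigma>, \<rho>, p)" by (cases q)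
    have "real (card {w\<in>G. P w q}) \<ge> \<gamma> * (real U)\<^sup>2"
      using q(2) divide_right_mono[OF Gcard, of "real (card Q)"] by (simp add: \<gamma>_def)
    moreover have "{w\<in>G. P w q} \<subseteq> {..<U} \<times> {..<U}" by (auto simp: G_def B_def)
    moreover have "\<forall>i<k. \<sigma> i < m \<and> \<rho> i < m" using q(1) unfolding qe Q_def by auto
    ultimately show "recurrent_config k m \<gamma> (n div m + 1) E f"
      unfolding U_def[symmetric] recurrent_config_def
      by (intro exI[of _ \<sigma>] exI[of _ \<rho>] exI[of _ p] exI[of _ "{w\<in>G. P w q}"]) (auto simp: P_def qe)
  qed (use m \<gamma> in auto)
qed

text \<open>
  Two block pairs \<open>(u, v')\<close> and \<open>(u', v)\<close> with the same colour, joined by a third block pair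
  \<open>(u, v)\<close>, extend the configuration in \<open>(u, v)\<close> by one point from \<open>u'\<close> and one from \<open>v'\<close>.
\<close>
lemma config_forced_Suc:
  assumes forced: "config_forced k" and k: "k \<ge> 1"
  shows "config_forced (Suc k)"
  unfolding config_forced_def
proof (intro allI impI)
  fix c D :: real assume cD: "c > 0" "D > 0"
  obtain m \<gamma> n1 where m: "m > 0" and \<gamma>: "\<gamma> > 0" and pop: "\<And>n N f E. n \<ge> n1 \<Longrightarrow> monotone_grid n N f E \<Longrightarrow>
     real N \<le> D * real n \<Longrightarrow> real (card E) \<ge> c * (real n)\<^sup>2 \<Longrightarrow>
     recurrent_config k m \<gamma> (n div m + 1) E f"
    using popular_pattern[OF forced _ cD] k by (metis (no_types) less_eq_Suc_le One_nat_def)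
  \<comment> \<open>The colours are among the \<open>N + 1\<close> possible values of
    \<open>f\<close>, and \<open>n \<le> U * m\<close> turns \<open>D * n + 1\<close> into at most
    \<open>(D * m + 1) * U\<close>.\<close>
  have Dm: "D * real m + 1 > 0" using cD by (simp add: add_nonneg_pos)
  obtain n2 where n2: "\<And>n E (F :: nat \<times> nat \<Rightarrow> nat). n \<ge> n2 \<Longrightarrow>
      real (card (F ` E)) \<le> (D * real m + 1) * real n \<Longrightarrow>
      real (card E) \<ge> \<gamma> * (real n)\<^sup>2 \<Longrightarrow> \<not> induced_colouring n E F"
    using dense_not_induced[OF \<gamma> Dm, where 'c = nat] by blast
  show "\<exists>n0. \<forall>n\<ge>n0. \<forall>N f E. monotone_grid n N f E \<longrightarrow> real N \<le> D * real n \<longrightarrow>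
     real (card E) \<ge> c * (real n)\<^sup>2 \<longrightarrow> (\<exists>x y. symmetric_config (Suc k) E f x y)"
  proof (intro exI[of _ "max n1 (n2 * m)"] allI impI)
    fix n N f E
    assume n: "max n1 (n2 * m) \<le> n" and sys: "monotone_grid n N f E" and N: "real N \<le> D * real n"
      and dense: "c * (real n)\<^sup>2 \<le> real (card E)"
    define U where "U = n div m + 1"
    have U2: "U \<ge> n2"
      using n m unfolding U_def by (metis div_le_mono max.bounded_iff nonzero_mult_div_cancel_right not_less0 trans_le_add1)
    have nU: "n \<le> U * m"
      unfolding U_def by (metis add.commute add_mult_distrib dividend_less_times_div less_or_eq_imp_le mult.commute mult_1 m(1))
    have fN: "\<And>i j. f i j \<le> N"
      and col: "\<And>i i' j. (i, j) \<in> E \<Longrightarrow> (i', j) \<in> E \<Longrightarrow> f i j = f i' j \<Longrightarrow> i = i'"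
      and row: "\<And>i j j'. (i, j) \<in> E \<Longrightarrow> (i, j') \<in> E \<Longrightarrow> f i j = f i j' \<Longrightarrow> j = j'"
      using sys unfolding monotone_grid_def by blast+
    have "recurrent_config k m \<gamma> U E f" using pop[OF _ sys N dense] n unfolding U_def by simp
    then obtain \<sigma> \<rho> p W where W: "W \<subseteq> {..<U} \<times> {..<U}" "real (card W) \<ge> \<gamma> * (real U)\<^sup>2"
      and bd: "\<And>i. i < k \<Longrightarrow> \<sigma> i < m \<and> \<rho> i < m"
      and conf: "\<And>u v. (u, v) \<in> W \<Longrightarrow> symmetric_config k E f (\<lambda>i. u * m + \<sigma> i) (\<lambda>j. v * m + \<rho> j)"
      and offs: "\<And>u v i j. (u, v) \<in> W \<Longrightarrow> i < k \<Longrightarrow> j < k \<Longrightarrow>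
           f (u * m + \<sigma> i) (v * m + \<rho> j) = f (u * m) (v * m) + p (i, j)"
      unfolding recurrent_config_def by blast
    define F where "F = (\<lambda>(u, v). f (u * m) (v * m))"
    have k0: "0 < k" using k by simp
    have e0: "(u * m + \<sigma> i, v * m + \<rho> 0) \<in> E" "(u * m + \<sigma> 0, v * m + \<rho> i) \<in> E"
      if "(u, v) \<in> W" "i < k" for u v i
    proof -
      have *: "symmetric_config k E f (\<lambda>i. u * m + \<sigma> i) (\<lambda>j. v * m + \<rho> j)" by (rule conf[OF that(1)])
      show "(u * m + \<sigma> i, v * m + \<rho> 0) \<in> E" "(u * m + \<sigma> 0, v * m + \<rho> i) \<in> E"
        using * that(2) k0 unfolding symmetric_config_def by (cases "i = 0"; blast)+
    qed
    have Frow: "v = v'" if "(u, v) \<in> W" "(u, v') \<in> W" "F (u, v) = F (u, v')" for u v v'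
    proof -
      have "f (u * m + \<sigma> 0) (v * m + \<rho> 0) = f (u * m + \<sigma> 0) (v' * m + \<rho> 0)"
        using that k0 by (simp add: offs F_def)
      from row[OF e0(1)[OF that(1) k0] e0(1)[OF that(2) k0] this] show ?thesis using m by simp
    qed
    have Fcol: "u = u'" if "(u, v) \<in> W" "(u', v) \<in> W" "F (u, v) = F (u', v)" for u u' v
    proof -
      have "f (u * m + \<sigma> 0) (v * m + \<rho> 0) = f (u' * m + \<sigma> 0) (v * m + \<rho> 0)"
        using that k0 by (simp add: offs F_def)
      from col[OF e0(1)[OF that(1) k0] e0(1)[OF that(2) k0] this] show ?thesis using m by simp
    qed
    have "real (card (F ` W)) \<le> (D * real m + 1) * real U"
    proof -
      have "F ` W \<subseteq> {..N}" using fN by (auto simp: F_def)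
      then have "card (F ` W) \<le> N + 1" using card_mono[of "{..N}" "F ` W"] by simp
      then have "real (card (F ` W)) \<le> D * real n + 1" using N by linarith
      moreover have "real n \<le> real U * real m" using nU by (metis of_nat_le_iff of_nat_mult)
      then have "D * real n \<le> D * (real U * real m)" using cD by simp
      moreover have "1 \<le> real U" by (simp add: U_def)
      ultimately show ?thesis by (simp add: algebra_simps)
    qed
    then have "\<not> induced_colouring U W F" using n2[OF U2 _ W(2)] by blast
    \<comment> \<open>\<open>Frow\<close> and \<open>Fcol\<close> exclude the first two ways in
      which an induced colouring can fail, so the third one occurs.\<close>
    then obtain u u' v v' where q: "(u, v) \<in> W" "(u, v') \<in> W" "(u', v) \<in> W" "F (u, v') = F (u', v)" "u \<noteq> u'"
      using W(1) Frow Fcol unfolding induced_colouring_def by blast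
    then have "v \<noteq> v'" using Fcol by metis
    define x where "x i = (if i < k then u * m + \<sigma> i else u' * m + \<sigma> 0)" for i
    define y where "y i = (if i < k then v * m + \<rho> i else v' * m + \<rho> 0)" for i
    have far: "a * m + s \<noteq> b * m + t" if "a \<noteq> b" "s < m" "t < m" for a b s t
    proof
      assume "a * m + s = b * m + t"
      then have "(a * m + s) div m = (b * m + t) div m" by simp
      then show False using that by simp
    qed
    have cuv: "inj_on (\<lambda>i. u * m + \<sigma> i) {..<k}" "inj_on (\<lambda>i. v * m + \<rho> i) {..<k}"
      "\<And>i j. i < k \<Longrightarrow> j < k \<Longrightarrow> i \<noteq> j \<Longrightarrow> (u * m + \<sigma> i, v * m + \<rho> j) \<in> E \<and>
         f (u * m + \<sigma> i) (v * m + \<rho> j) = f (u * m + \<sigma> j) (v * m + \<rho> i)"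
      using conf[OF q(1)] unfolding symmetric_config_def by auto
    \<comment> \<open>The offset table inherits symmetry from the configuration in
      \<open>(u, v)\<close>. With equal colours, position \<open>(i, 0)\<close> in
      \<open>(u, v')\<close> and position \<open>(0, i)\<close> in \<open>(u', v)\<close> therefore
      carry the same value.\<close>
    have psym: "p (i, j) = p (j, i)" if "i < k" "j < k" for i j
      using cuv(3)[of i j] offs[OF q(1) that] offs[OF q(1) that(2,1)] that by (cases "i = j") auto
    have new: "(x i, y k) \<in> E" "(x k, y i) \<in> E" "f (x i) (y k) = f (x k) (y i)" if "i < k" for i
      using e0(1)[OF q(2) that] e0(2)[OF q(3) that] q(4) that k0 offs[OF q(2) that k0] offs[OF q(3) k0 that]
        psym[OF that k0] by (simp_all add: x_def y_def F_def)
    have "symmetric_config (Suc k) E f x y"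
      unfolding symmetric_config_def
    proof (intro conjI allI impI)
      have "inj_on x {..<k}" using cuv(1) by (simp add: inj_on_def x_def)
      moreover have "x k \<notin> x ` {..<k}"
      proof
        assume "x k \<in> x ` {..<k}"
        then obtain i where "i < k" "u * m + \<sigma> i = u' * m + \<sigma> 0" by (auto simp: x_def)
        then show False using far[OF q(5)] bd k0 by blast
      qed
      ultimately show "inj_on x {..<Suc k}" by (simp add: lessThan_Suc)
      have "inj_on y {..<k}" using cuv(2) by (simp add: inj_on_def y_def)
      moreover have "y k \<notin> y ` {..<k}"
      proof
        assume "y k \<in> y ` {..<k}"
        then obtain i where "i < k" "v * m + \<rho> i = v' * m + \<rho> 0" by (auto simp: y_def)
        then show False using far[OF \<open>v \<noteq> v'\<close>] bd k0 by blast
      qed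
      ultimately show "inj_on y {..<Suc k}" by (simp add: lessThan_Suc)
      show "(x 0, y 0) \<in> E" using e0(1)[OF q(1) k0] k0 by (simp add: x_def y_def)
    next
      fix i j assume ij: "i < Suc k" "j < Suc k" "i \<noteq> j"
      then consider "i < k" "j < k" | "i < k" "j = k" | "i = k" "j < k" by linarith
      then show "(x i, y j) \<in> E" "f (x i) (y j) = f (x j) (y i)"
        using cuv(3)[of i j] ij new by (cases; simp add: x_def y_def)+
    qed
    then show "\<exists>x y. symmetric_config (Suc k) E f x y" by blast
  qed
qed

lemma config_forced:
  assumes "k \<ge> 1"
  shows "config_forced k"
  using assms config_forced_1 config_forced_Suc by (induction k rule: dec_induct) auto

section \<open>Conics through configurations\<close>

definition cross2 :: "real ^ 2 \<Rightarrow> real ^ 2 \<Rightarrow> real" where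
  "cross2 p q = p $ 1 * q $ 2 - p $ 2 * q $ 1"

definition noncollinear3 :: "real ^ 2 \<Rightarrow> real ^ 2 \<Rightarrow> real ^ 2 \<Rightarrow> bool" where
  "noncollinear3 p q r \<longleftrightarrow> cross2 (q - p) (r - p) \<noteq> 0"

lemma vec2_eq_iff: "(p :: real ^ 2) = q \<longleftrightarrow> p $ 1 = q $ 1 \<and> p $ 2 = q $ 2"
  by (simp add: vec_eq_iff forall_2)

text \<open>
  The hypothesis says that \<open>a\<^sub>i \<times> a\<^sub>j - b\<^sub>i \<times> b\<^sub>j = \<kappa>\<^sub>i - \<kappa>\<^sub>j\<close> with \<open>\<kappa>\<^sub>i = a\<^sub>i \<times> b\<^sub>i\<close>, that is, the vectors
  \<open>(a\<^sub>i, b\<^sub>i, \<kappa>\<^sub>i, 1)\<close> span an isotropic subspace of a six-dimensional symplectic space. Its dimension is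
  at most three, so \<open>b\<^sub>i\<close> is an affine function \<open>M a\<^sub>i + t\<close> of \<open>a\<^sub>i\<close>, and then \<open>\<kappa>\<^sub>i\<close> is affine in \<open>a\<^sub>i\<close> as well:
  this is the equation of a conic. Its quadratic part \<open>a \<times> M a\<close> vanishes only for \<open>M = \<plusminus>1\<close>.
\<close>
lemma symmetric_config_conic:
  fixes a b :: "nat \<Rightarrow> real ^ 2"
  assumes k: "k \<ge> 3"
    and par: "\<And>i j. i < k \<Longrightarrow> j < k \<Longrightarrow> i \<noteq> j \<Longrightarrow> cross2 (a i - b j) (a j - b i) = 0"
    and nc: "noncollinear3 (a 0) (a 1) (a 2)" and ne: "a 0 \<noteq> b 0"
  shows "(\<exists>t. \<forall>i<k. b i = t - a i) \<or> (\<exists>C. is_conic C \<and> (\<forall>i<k. a i \<in> C \<and> b i \<in> C))"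
proof -
  define p q r s where "p i = a i $ 1" and "q i = a i $ 2" and "r i = b i $ 1" and "s i = b i $ 2" for i
  have R: "p i * q j - q i * p j - (r i * s j - s i * r j) = (p i * s i - q i * r i) - (p j * s j - q j * r j)"
    if "i < k" "j < k" for i j
    using par[OF that] by (cases "i = j") (simp_all add: cross2_def p_def q_def r_def s_def algebra_simps)
  define \<Delta> where "\<Delta> = (p 1 - p 0) * (q 2 - q 0) - (q 1 - q 0) * (p 2 - p 0)"
  have \<Delta>: "\<Delta> \<noteq> 0" using nc by (simp add: noncollinear3_def cross2_def p_def q_def \<Delta>_def)
  \<comment> \<open>Three instances of \<open>R\<close> around the indices \<open>0\<close>,
    \<open>i\<close>, \<open>j\<close> cancel the right-hand sides. What remains says that
    corresponding triangles of \<open>a\<close> and \<open>b\<close> have equal signed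
    areas.\<close>
  have area: "(p i - p 0) * (q j - q 0) - (q i - q 0) * (p j - p 0)
      = (r i - r 0) * (s j - s 0) - (s i - s 0) * (r j - r 0)" if "i < k" "j < k" for i j
    using R[OF that] R[OF that(1), of 0] R[of 0 j] that k by (simp add: algebra_simps)
  have \<Delta>b: "(r 1 - r 0) * (s 2 - s 0) - (s 1 - s 0) * (r 2 - r 0) = \<Delta>"
    using area[of 1 2] k by (simp add: \<Delta>_def)
  \<comment> \<open>Cramer's rule for the linear map taking \<open>a 1 - a 0\<close> and
    \<open>a 2 - a 0\<close> to the corresponding sides of \<open>b\<close>.\<close>
  define m11 where "m11 = ((q 2 - q 0) * (r 1 - r 0) - (q 1 - q 0) * (r 2 - r 0)) / \<Delta>"
  define m12 where "m12 = ((p 1 - p 0) * (r 2 - r 0) - (p 2 - p 0) * (r 1 - r 0)) / \<Delta>"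
  define m21 where "m21 = ((q 2 - q 0) * (s 1 - s 0) - (q 1 - q 0) * (s 2 - s 0)) / \<Delta>"
  define m22 where "m22 = ((p 1 - p 0) * (s 2 - s 0) - (p 2 - p 0) * (s 1 - s 0)) / \<Delta>"
  have m: "\<Delta> * m11 = (q 2 - q 0) * (r 1 - r 0) - (q 1 - q 0) * (r 2 - r 0)"
    "\<Delta> * m12 = (p 1 - p 0) * (r 2 - r 0) - (p 2 - p 0) * (r 1 - r 0)"
    "\<Delta> * m21 = (q 2 - q 0) * (s 1 - s 0) - (q 1 - q 0) * (s 2 - s 0)"
    "\<Delta> * m22 = (p 1 - p 0) * (s 2 - s 0) - (p 2 - p 0) * (s 1 - s 0)"
    using \<Delta> by (simp_all add: m11_def m12_def m21_def m22_def)
  have aff0: "r i - r 0 = m11 * (p i - p 0) + m12 * (q i - q 0)"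
    "s i - s 0 = m21 * (p i - p 0) + m22 * (q i - q 0)" if i: "i < k" for i
  proof -
    define P Q X Y where "P = p i - p 0" and "Q = q i - q 0" and "X = r i - r 0" and "Y = s i - s 0"
    define P1 Q1 X1 Y1 where "P1 = p 1 - p 0" and "Q1 = q 1 - q 0" and "X1 = r 1 - r 0" and "Y1 = s 1 - s 0"
    define P2 Q2 X2 Y2 where "P2 = p 2 - p 0" and "Q2 = q 2 - q 0" and "X2 = r 2 - r 0" and "Y2 = s 2 - s 0"
    have a1: "P * Q1 - Q * P1 = X * Y1 - Y * X1" and a2: "P * Q2 - Q * P2 = X * Y2 - Y * X2"
      using area[OF i, of 1] area[OF i, of 2] k
      by (simp_all add: P_def Q_def X_def Y_def P1_def Q1_def X1_def Y1_def P2_def Q2_def X2_def Y2_def)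
    have d: "X1 * Y2 - Y1 * X2 = \<Delta>"
      using \<Delta>b by (simp add: X1_def Y1_def X2_def Y2_def)
    have "\<Delta> * X = X1 * (X * Y2 - Y * X2) - X2 * (X * Y1 - Y * X1)"
      unfolding d[symmetric] by (simp add: algebra_simps)
    also have "\<dots> = (\<Delta> * m11) * P + (\<Delta> * m12) * Q"
      unfolding a1[symmetric] a2[symmetric] m P1_def[symmetric] Q1_def[symmetric] X1_def[symmetric]
        P2_def[symmetric] Q2_def[symmetric] X2_def[symmetric]
      by (simp add: algebra_simps)
    finally have "\<Delta> * X = \<Delta> * (m11 * P + m12 * Q)" by (simp add: algebra_simps)
    then show "r i - r 0 = m11 * (p i - p 0) + m12 * (q i - q 0)"
      using \<Delta> by (simp add: X_def P_def Q_def)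
    have "\<Delta> * Y = Y1 * (X * Y2 - Y * X2) - Y2 * (X * Y1 - Y * X1)"
      unfolding d[symmetric] by (simp add: algebra_simps)
    also have "\<dots> = (\<Delta> * m21) * P + (\<Delta> * m22) * Q"
      unfolding a1[symmetric] a2[symmetric] m P1_def[symmetric] Q1_def[symmetric] Y1_def[symmetric]
        P2_def[symmetric] Q2_def[symmetric] Y2_def[symmetric]
      by (simp add: algebra_simps)
    finally have "\<Delta> * Y = \<Delta> * (m21 * P + m22 * Q)" by (simp add: algebra_simps)
    then show "s i - s 0 = m21 * (p i - p 0) + m22 * (q i - q 0)"
      using \<Delta> by (simp add: Y_def P_def Q_def)
  qed
  define t1 where "t1 = r 0 - (m11 * p 0 + m12 * q 0)"
  define t2 where "t2 = s 0 - (m21 * p 0 + m22 * q 0)"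
  have aff: "r i = m11 * p i + m12 * q i + t1" "s i = m21 * p i + m22 * q i + t2" if "i < k" for i
    using aff0[OF that] by (simp_all add: t1_def t2_def algebra_simps)
  have k1: "1 < k" and k2: "2 < k" using k by auto
  have det: "m11 * m22 - m12 * m21 = 1"
  proof -
    have "(r 1 - r 0) * (s 2 - s 0) - (s 1 - s 0) * (r 2 - r 0) = (m11 * m22 - m12 * m21) * \<Delta>"
      unfolding aff0(1)[OF k1] aff0(2)[OF k1] aff0(1)[OF k2] aff0(2)[OF k2] \<Delta>_def
      by (simp add: algebra_simps)
    then show ?thesis using \<Delta>b \<Delta> by simp
  qed
  \<comment> \<open>The constant that makes \<open>Q\<close> vanish at \<open>a 0\<close>;
    \<open>R\<close> against index 0 then carries the vanishing to every \<open>a i\<close>.\<close>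
  define l0 where "l0 = p 0 * s 0 - q 0 * r 0 - (t1 * (m21 * p 0 + m22 * q 0) - t2 * (m11 * p 0 + m12 * q 0))"
  define Q where "Q x y = m21 * x\<^sup>2 + (m22 - m11) * x * y + (- m12) * y\<^sup>2
      + (t2 - t1 * m21 + t2 * m11) * x + (t2 * m12 - t1 - t1 * m22) * y + (- l0)" for x y
  have Qa: "Q (p i) (q i) = 0" if i: "i < k" for i
  proof -
    have "(p i * s i - q i * r i) - (p 0 * s 0 - q 0 * r 0)
        = (1 - (m11 * m22 - m12 * m21)) * (p i * q 0 - q i * p 0)
          - ((m11 * p i + m12 * q i) * t2 - (m21 * p i + m22 * q i) * t1)
          + ((m11 * p 0 + m12 * q 0) * t2 - (m21 * p 0 + m22 * q 0) * t1)"
      using R[OF i, of 0] k unfolding aff[OF i] aff[of 0, OF order.strict_trans2[OF _ k, of 0, simplified]]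
      by (simp add: algebra_simps)
    then have "p i * s i - q i * r i = t1 * (m21 * p i + m22 * q i) - t2 * (m11 * p i + m12 * q i) + l0"
      unfolding l0_def det by (simp add: algebra_simps)
    then show ?thesis unfolding Q_def aff[OF i] by (simp add: algebra_simps power2_eq_square)
  qed
  \<comment> \<open>\<open>Q\<close> is invariant under the affine map \<open>a i\<close> to
    \<open>b i\<close>, whose linear part has determinant one.\<close>
  have Qb: "Q (r i) (s i) = 0" if i: "i < k" for i
  proof -
    have "Q (r i) (s i) = Q (p i) (q i) + (m11 * m22 - m12 * m21 - 1) *
        (p i * (m21 * p i + m22 * q i) - q i * (m11 * p i + m12 * q i) + (p i * t2 - q i * t1))"
      unfolding Q_def aff[OF i] by (simp add: algebra_simps power2_eq_square)
    then show ?thesis using Qa[OF i] det by simp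
  qed
  show ?thesis
  proof (cases "m21 = 0 \<and> m22 - m11 = 0 \<and> - m12 = 0")
    case False
    have "is_conic {x. Q (x $ 1) (x $ 2) = 0}"
      unfolding is_conic_def Q_def using False
      by (intro exI[of _ m21] exI[of _ "m22 - m11"] exI[of _ "- m12"] exI[of _ "t2 - t1 * m21 + t2 * m11"]
          exI[of _ "t2 * m12 - t1 - t1 * m22"] exI[of _ "- l0"] conjI refl) (simp only: prod.inject; blast)
    then show ?thesis using Qa Qb unfolding p_def q_def r_def s_def by blast
  next
    case True
    then have M: "m21 = 0" "m22 = m11" "m12 = 0" by auto
    then have "m11 * m11 = 1" using det by simp
    then consider "m11 = 1" | "m11 = - 1" by (metis square_eq_1_iff)
    then show ?thesis
    proof cases
      \<comment> \<open>For a translation, \<open>R\<close> forces the translation vector to be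
        parallel to two independent sides of the triangle. It is then zero, against
        \<open>ne\<close>.\<close>
      case 1
      have tr: "r i = p i + t1" "s i = q i + t2" if "i < k" for i using aff[OF that] M 1 by auto
      have "(p i - p 0) * t2 - (q i - q 0) * t1 = 0" if "i < k" for i
        using R[OF that, of 0] k tr[OF that] tr[of 0] by (simp add: algebra_simps)
      from this[of 1] this[of 2] have e: "(p 1 - p 0) * t2 = (q 1 - q 0) * t1" "(p 2 - p 0) * t2 = (q 2 - q 0) * t1"
        using k by auto
      have "\<Delta> * t2 = (q 2 - q 0) * ((p 1 - p 0) * t2) - (q 1 - q 0) * ((p 2 - p 0) * t2)"
        by (simp add: \<Delta>_def algebra_simps)
      also have "\<dots> = 0" unfolding e by (simp add: algebra_simps)
      finally have "t2 = 0" using \<Delta> by simp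
      moreover have "\<Delta> * t1 = (p 1 - p 0) * ((q 2 - q 0) * t1) - (p 2 - p 0) * ((q 1 - q 0) * t1)"
        by (simp add: \<Delta>_def algebra_simps)
      then have "\<Delta> * t1 = 0" unfolding e[symmetric] by (simp add: algebra_simps)
      then have "t1 = 0" using \<Delta> by simp
      ultimately have "a 0 = b 0" using tr[of 0] k by (simp add: vec2_eq_iff p_def q_def r_def s_def)
      then show ?thesis using ne by simp
    next
      case 2
      have "b i = vector [t1, t2] - a i" if "i < k" for i
        using aff[OF that] M 2 by (simp add: vec2_eq_iff p_def q_def r_def s_def)
      then show ?thesis by blast
    qed
  qed
qed

text \<open>
  In the affine frame of \<open>P\<^sub>0, P\<^sub>1, P\<^sub>2\<close> a quadratic polynomial vanishing at these points has the form
  \<open>\<alpha> x (x - 1) + \<beta> x y + \<gamma> y (y - 1)\<close>, and vanishing at \<open>P\<^sub>3, P\<^sub>4\<close> determines \<open>\<alpha> : \<beta> : \<gamma>\<close>.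
\<close>
lemma conic_through_five_points:
  fixes P :: "nat \<Rightarrow> real ^ 2"
  assumes C: "is_conic C" "\<And>i. i < 5 \<Longrightarrow> P i \<in> C" and C': "is_conic C'" "\<And>i. i < 5 \<Longrightarrow> P i \<in> C'"
    and nc: "\<And>i j k. i < 5 \<Longrightarrow> j < 5 \<Longrightarrow> k < 5 \<Longrightarrow> i \<noteq> j \<Longrightarrow> i \<noteq> k \<Longrightarrow> j \<noteq> k \<Longrightarrow> noncollinear3 (P i) (P j) (P k)"
  shows "C = C'"
proof -
  define e1 e2 g1 g2 where "e1 = (P 1 - P 0) $ 1" and "e2 = (P 1 - P 0) $ 2"
    and "g1 = (P 2 - P 0) $ 1" and "g2 = (P 2 - P 0) $ 2"
  define \<Delta> where "\<Delta> = e1 * g2 - e2 * g1"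
  have \<Delta>: "\<Delta> \<noteq> 0" using nc[of 0 1 2] by (simp add: noncollinear3_def cross2_def e1_def e2_def g1_def g2_def \<Delta>_def)
  define X :: "real ^ 2 \<Rightarrow> real" where "X z = ((z $ 1 - P 0 $ 1) * g2 - (z $ 2 - P 0 $ 2) * g1) / \<Delta>" for z
  define Y :: "real ^ 2 \<Rightarrow> real" where "Y z = (e1 * (z $ 2 - P 0 $ 2) - e2 * (z $ 1 - P 0 $ 1)) / \<Delta>" for z
  have XY: "z $ 1 = P 0 $ 1 + X z * e1 + Y z * g1" "z $ 2 = P 0 $ 2 + X z * e2 + Y z * g2" for z :: "real ^ 2"
  proof -
    have d: "\<Delta> * X z = (z $ 1 - P 0 $ 1) * g2 - (z $ 2 - P 0 $ 2) * g1"
      "\<Delta> * Y z = e1 * (z $ 2 - P 0 $ 2) - e2 * (z $ 1 - P 0 $ 1)"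
      using \<Delta> by (simp_all add: X_def Y_def)
    have "\<Delta> * (X z * e1 + Y z * g1) = \<Delta> * (z $ 1 - P 0 $ 1)"
      unfolding distrib_left mult.assoc[symmetric] d by (simp add: \<Delta>_def algebra_simps)
    then show "z $ 1 = P 0 $ 1 + X z * e1 + Y z * g1" using \<Delta> by simp
    have "\<Delta> * (X z * e2 + Y z * g2) = \<Delta> * (z $ 2 - P 0 $ 2)"
      unfolding distrib_left mult.assoc[symmetric] d by (simp add: \<Delta>_def algebra_simps)
    then show "z $ 2 = P 0 $ 2 + X z * e2 + Y z * g2" using \<Delta> by simp
  qed
  have col: "(X (P j) - X (P i)) * (Y (P k) - Y (P i)) - (Y (P j) - Y (P i)) * (X (P k) - X (P i)) \<noteq> 0"
    if "i < 5" "j < 5" "k < 5" "i \<noteq> j" "i \<noteq> k" "j \<noteq> k" for i j k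
  proof -
    have "cross2 (P j - P i) (P k - P i) = \<Delta> *
      ((X (P j) - X (P i)) * (Y (P k) - Y (P i)) - (Y (P j) - Y (P i)) * (X (P k) - X (P i)))"
      unfolding cross2_def vector_minus_component XY[of "P i"] XY[of "P j"] XY[of "P k"]
      by (simp add: \<Delta>_def algebra_simps)
    then show ?thesis using nc[OF that] by (auto simp: noncollinear3_def)
  qed
  have x0: "X (P 0) = 0" "Y (P 0) = 0" by (auto simp: X_def Y_def)
  have x1: "X (P (Suc 0)) = 1" "Y (P (Suc 0)) = 0" using \<Delta>
    by (auto simp: X_def Y_def \<Delta>_def e1_def e2_def g1_def g2_def)
  have x2: "X (P 2) = 0" "Y (P 2) = 1" using \<Delta>
    by (auto simp: X_def Y_def \<Delta>_def e1_def e2_def g1_def g2_def)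
  define x3 y3 x4 y4 where "x3 = X (P 3)" and "y3 = Y (P 3)" and "x4 = X (P 4)" and "y4 = Y (P 4)"
  have nz: "x3 \<noteq> 0" "y3 \<noteq> 0" "x4 \<noteq> 0" "y4 \<noteq> 0"
    using col[of 0 2 3] col[of 0 1 3] col[of 0 2 4] col[of 0 1 4]
    by (auto simp: x0 x1 x2 x3_def y3_def x4_def y4_def)
  have d1: "(x3 - 1) * y4 - y3 * (x4 - 1) \<noteq> 0"
    using col[of 1 3 4] by (simp add: x0 x1 x2 x3_def y3_def x4_def y4_def)
  have d2: "x3 * (y4 - 1) - (y3 - 1) * x4 \<noteq> 0"
    using col[of 2 3 4] by (simp add: x0 x1 x2 x3_def y3_def x4_def y4_def)
  \<comment> \<open>Once \<open>\<alpha> \<noteq> 0\<close>, the equations at \<open>P 3\<close> and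
    \<open>P 4\<close> fix \<open>\<gamma>\<close> and \<open>\<beta>\<close> as multiples of
    \<open>\<alpha>\<close> that do not depend on the conic.\<close>
  have shape: "\<exists>\<alpha> \<beta> \<gamma>. \<alpha> \<noteq> 0 \<and> \<beta> = - \<alpha> * ((x3 - 1) / y3) - \<gamma> * ((y3 - 1) / x3) \<and>
      \<gamma> * ((y3 - 1) / x3 - (y4 - 1) / x4) = - \<alpha> * ((x3 - 1) / y3 - (x4 - 1) / y4) \<and>
      B = {z. \<alpha> * (X z * (X z - 1)) + \<beta> * (X z * Y z) + \<gamma> * (Y z * (Y z - 1)) = 0}"
    if B: "is_conic B" "\<And>i. i < 5 \<Longrightarrow> P i \<in> B" for B
  proof -
    obtain A1 A2 A3 A4 A5 A6 where A: "(A1, A2, A3) \<noteq> (0, 0, 0 :: real)" and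
      Beq: "B = {p. A1 * (p $ 1)\<^sup>2 + A2 * (p $ 1) * (p $ 2) + A3 * (p $ 2)\<^sup>2 + A4 * (p $ 1) + A5 * (p $ 2) + A6 = 0}"
      using B(1) unfolding is_conic_def by blast
    define \<alpha> where "\<alpha> = A1 * e1\<^sup>2 + A2 * e1 * e2 + A3 * e2\<^sup>2"
    define \<beta> where "\<beta> = 2 * A1 * e1 * g1 + A2 * (e1 * g2 + e2 * g1) + 2 * A3 * e2 * g2"
    define \<gamma> where "\<gamma> = A1 * g1\<^sup>2 + A2 * g1 * g2 + A3 * g2\<^sup>2"
    define l1 where "l1 = 2 * A1 * P 0 $ 1 * e1 + A2 * (P 0 $ 1 * e2 + P 0 $ 2 * e1) + 2 * A3 * P 0 $ 2 * e2 + A4 * e1 + A5 * e2"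
    define l2 where "l2 = 2 * A1 * P 0 $ 1 * g1 + A2 * (P 0 $ 1 * g2 + P 0 $ 2 * g1) + 2 * A3 * P 0 $ 2 * g2 + A4 * g1 + A5 * g2"
    define l0 where "l0 = A1 * (P 0 $ 1)\<^sup>2 + A2 * (P 0 $ 1) * (P 0 $ 2) + A3 * (P 0 $ 2)\<^sup>2 + A4 * (P 0 $ 1) + A5 * (P 0 $ 2) + A6"
    have ex: "A1 * (z $ 1)\<^sup>2 + A2 * (z $ 1) * (z $ 2) + A3 * (z $ 2)\<^sup>2 + A4 * (z $ 1) + A5 * (z $ 2) + A6
      = \<alpha> * (X z)\<^sup>2 + \<beta> * (X z * Y z) + \<gamma> * (Y z)\<^sup>2 + l1 * X z + l2 * Y z + l0" for z
      unfolding XY[of z] \<alpha>_def \<beta>_def \<gamma>_def l1_def l2_def l0_def by (simp add: algebra_simps power2_eq_square)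
    have B': "z \<in> B \<longleftrightarrow> \<alpha> * (X z)\<^sup>2 + \<beta> * (X z * Y z) + \<gamma> * (Y z)\<^sup>2 + l1 * X z + l2 * Y z + l0 = 0" for z
      unfolding Beq by (simp add: ex)
    have "l0 = 0" using B(2)[of 0] by (simp add: B' x0)
    moreover have "l1 = - \<alpha>" using B(2)[of 1] \<open>l0 = 0\<close> by (simp add: B' x1 add_eq_0_iff)
    moreover have "l2 = - \<gamma>" using B(2)[of 2] \<open>l0 = 0\<close> by (simp add: B' x2 add_eq_0_iff)
    ultimately have B'': "z \<in> B \<longleftrightarrow> \<alpha> * (X z * (X z - 1)) + \<beta> * (X z * Y z) + \<gamma> * (Y z * (Y z - 1)) = 0" for z
      unfolding B' by (simp add: algebra_simps power2_eq_square)
    have "\<alpha> * (x3 * (x3 - 1)) + \<beta> * (x3 * y3) + \<gamma> * (y3 * (y3 - 1)) = 0"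
      using B(2)[of 3] by (simp add: B'' x3_def y3_def)
    then have b3: "\<beta> = - \<alpha> * ((x3 - 1) / y3) - \<gamma> * ((y3 - 1) / x3)"
      using nz by (simp add: field_simps; algebra)
    have "\<alpha> * (x4 * (x4 - 1)) + \<beta> * (x4 * y4) + \<gamma> * (y4 * (y4 - 1)) = 0"
      using B(2)[of 4] by (simp add: B'' x4_def y4_def)
    then have b4: "\<beta> = - \<alpha> * ((x4 - 1) / y4) - \<gamma> * ((y4 - 1) / x4)"
      using nz by (simp add: field_simps; algebra)
    have g: "\<gamma> * ((y3 - 1) / x3 - (y4 - 1) / x4) = - \<alpha> * ((x3 - 1) / y3 - (x4 - 1) / y4)"
      using b3 b4 by (simp add: algebra_simps)
    \<comment> \<open>If \<open>\<alpha> = 0\<close>, non-collinearity of \<open>P 2\<close>,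
      \<open>P 3\<close>, \<open>P 4\<close> kills \<open>\<gamma>\<close> and then
      \<open>\<beta>\<close>. Inverting the change of coordinates, the quadratic part of the
      original equation would vanish.\<close>
    have "\<alpha> \<noteq> 0"
    proof
      assume "\<alpha> = 0"
      moreover have "(y3 - 1) / x3 - (y4 - 1) / x4 \<noteq> 0" using d2 nz by (simp add: field_simps)
      ultimately have "\<gamma> = 0" using g by simp
      then have "\<beta> = 0" using b3 \<open>\<alpha> = 0\<close> by simp
      have "\<Delta>\<^sup>2 * A1 = \<alpha> * g2\<^sup>2 - \<beta> * g2 * e2 + \<gamma> * e2\<^sup>2" "\<Delta>\<^sup>2 * A3 = \<alpha> * g1\<^sup>2 - \<beta> * g1 * e1 + \<gamma> * e1\<^sup>2"
        "\<Delta>\<^sup>2 * A2 = - 2 * \<alpha> * g1 * g2 + \<beta> * (e1 * g2 + e2 * g1) - 2 * \<gamma> * e1 * e2"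
        unfolding \<alpha>_def \<beta>_def \<gamma>_def \<Delta>_def by (simp_all add: algebra_simps power2_eq_square)
      then show False using A \<Delta> \<open>\<alpha> = 0\<close> \<open>\<beta> = 0\<close> \<open>\<gamma> = 0\<close> by simp
    qed
    then show ?thesis using b3 g B'' by blast
  qed
  obtain \<alpha> \<beta> \<gamma> where h: "\<alpha> \<noteq> 0" "\<beta> = - \<alpha> * ((x3 - 1) / y3) - \<gamma> * ((y3 - 1) / x3)"
      "\<gamma> * ((y3 - 1) / x3 - (y4 - 1) / x4) = - \<alpha> * ((x3 - 1) / y3 - (x4 - 1) / y4)"
      "C = {z. \<alpha> * (X z * (X z - 1)) + \<beta> * (X z * Y z) + \<gamma> * (Y z * (Y z - 1)) = 0}"
    using shape[OF C] by blast
  obtain \<alpha>' \<beta>' \<gamma>' where h': "\<alpha>' \<noteq> 0" "\<beta>' = - \<alpha>' * ((x3 - 1) / y3) - \<gamma>' * ((y3 - 1) / x3)"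
      "\<gamma>' * ((y3 - 1) / x3 - (y4 - 1) / x4) = - \<alpha>' * ((x3 - 1) / y3 - (x4 - 1) / y4)"
      "C' = {z. \<alpha>' * (X z * (X z - 1)) + \<beta>' * (X z * Y z) + \<gamma>' * (Y z * (Y z - 1)) = 0}"
    using shape[OF C'] by blast
  have d: "(y3 - 1) / x3 - (y4 - 1) / x4 \<noteq> 0" using d2 nz by (simp add: field_simps)
  have "(\<alpha>' * \<gamma>) * ((y3 - 1) / x3 - (y4 - 1) / x4) = (\<alpha> * \<gamma>') * ((y3 - 1) / x3 - (y4 - 1) / x4)"
    using h(3) h'(3) by (simp add: mult.assoc)
  then have pg: "\<alpha>' * \<gamma> = \<alpha> * \<gamma>'" using d by simp
  then have pb: "\<alpha>' * \<beta> = \<alpha> * \<beta>'"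
    unfolding h(2) h'(2) by (simp add: right_diff_distrib flip: mult.assoc)
  have "\<alpha>' * (\<alpha> * (X z * (X z - 1)) + \<beta> * (X z * Y z) + \<gamma> * (Y z * (Y z - 1)))
      = \<alpha> * (\<alpha>' * (X z * (X z - 1)) + \<beta>' * (X z * Y z) + \<gamma>' * (Y z * (Y z - 1)))" for z
    using pg pb by (simp add: distrib_left flip: mult.assoc)
  then have "\<alpha> * (X z * (X z - 1)) + \<beta> * (X z * Y z) + \<gamma> * (Y z * (Y z - 1)) = 0 \<longleftrightarrow>
      \<alpha>' * (X z * (X z - 1)) + \<beta>' * (X z * Y z) + \<gamma>' * (Y z * (Y z - 1)) = 0" for z
    using h(1) h'(1) by (metis mult_eq_0_iff)
  then show ?thesis unfolding h(4) h'(4) by simp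
qed

section \<open>Translates of a triangle\<close>

text \<open>Here \<open>w\<close> points into the cone of the triangle at \<open>P\<close>. Either
  \<open>P + w\<close> lies in the triangle, or the segment from \<open>P\<close> to
  \<open>P + w\<close> meets the side \<open>Q R\<close> in a point \<open>Z\<close>, and then
  \<open>P + w\<close> lies between \<open>Z\<close> and the point \<open>Z + w\<close> of the
  translated side.\<close>

lemma translated_triangle_aux:
  fixes P Q R w :: "real ^ 2"
  assumes A: "convex_position A" "{P, Q, R, P + w, Q + w, R + w} \<subseteq> A" "P + w \<notin> {P, Q, R}" "P \<noteq> Q" "P \<noteq> R"
    and w: "w = \<beta> *\<^sub>R (Q - P) + \<gamma> *\<^sub>R (R - P)" and nonneg: "\<beta> \<ge> 0" "\<gamma> \<ge> 0"
  shows False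
proof -
  define S where "S = convex hull (A - {P + w})"
  have conv: "convex S" by (simp add: S_def)
  have inS: "z \<in> S" if "z \<in> A" "z \<noteq> P + w" for z
    using that unfolding S_def by (intro hull_inc) auto
  have mem: "P \<in> S" "Q \<in> S" "R \<in> S" "Q + w \<in> S" "R + w \<in> S" using A by (auto intro!: inS)
  have "P + w \<in> S"
  proof (cases "\<beta> + \<gamma> \<le> 1")
    case True
    have "P + w = (1 - \<beta> - \<gamma>) *\<^sub>R P + \<beta> *\<^sub>R Q + \<gamma> *\<^sub>R R"
      unfolding w by (simp add: algebra_simps)
    also have "\<dots> \<in> convex hull {P, Q, R}"
      unfolding convex_hull_3 using True nonneg by (intro CollectI exI[of _ "1 - \<beta> - \<gamma>"] exI[of _ \<beta>] exI[of _ \<gamma>]) auto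
    also have "convex hull {P, Q, R} \<subseteq> S" using mem conv by (intro hull_minimal) auto
    finally show ?thesis .
  next
    case False
    define \<theta> where "\<theta> = 1 / (\<beta> + \<gamma>)"
    have \<theta>: "0 \<le> \<theta>" "\<theta> \<le> 1" "\<theta> * (\<beta> + \<gamma>) = 1" using False by (auto simp: \<theta>_def)
    have one: "\<theta> * \<beta> + \<theta> * \<gamma> = 1" "0 \<le> \<theta> * \<beta>" "0 \<le> \<theta> * \<gamma>"
      using \<theta> nonneg by (auto simp: algebra_simps)
    define Z where "Z = (\<theta> * \<beta>) *\<^sub>R Q + (\<theta> * \<gamma>) *\<^sub>R R"
    define Z' where "Z' = (\<theta> * \<beta>) *\<^sub>R (Q + w) + (\<theta> * \<gamma>) *\<^sub>R (R + w)"
    have "Z \<in> S" "Z' \<in> S" unfolding Z_def Z'_def using convexD[OF conv] mem one by blast+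
    then have "\<theta> *\<^sub>R Z + (1 - \<theta>) *\<^sub>R Z' \<in> S" using convexD[OF conv] \<theta> by auto
    moreover have "Z' = Z + w"
      unfolding Z_def Z'_def using one(1) by (simp add: algebra_simps flip: scaleR_left.add)
    moreover have "Z = P + \<theta> *\<^sub>R w"
    proof -
      have "P + \<theta> *\<^sub>R w = (1 - (\<theta> * \<beta> + \<theta> * \<gamma>)) *\<^sub>R P + Z"
        unfolding w Z_def by (simp add: algebra_simps)
      then show ?thesis using one(1) by simp
    qed
    ultimately show ?thesis by (simp add: algebra_simps)
  qed
  then show False using A unfolding convex_position_def S_def by auto
qed

text \<open>The components \<open>- \<beta> - \<gamma>\<close>, \<open>\<beta>\<close>,
  \<open>\<gamma>\<close> of \<open>w\<close> sum to zero, so two of them share a sign. If both are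
  nonnegative, \<open>w\<close> points into the cone at the third vertex; if both are nonpositive,
  \<open>- w\<close> does so in the translated triangle.\<close>

lemma no_translated_triangle:
  fixes P Q R w :: "real ^ 2"
  assumes A: "convex_position A" "{P, Q, R, P + w, Q + w, R + w} \<subseteq> A"
    and disj: "{P, Q, R} \<inter> {P + w, Q + w, R + w} = {}" and nc: "noncollinear3 P Q R"
  shows False
proof -
  have ne: "P \<noteq> Q" "P \<noteq> R" "Q \<noteq> R" using nc by (auto simp: noncollinear3_def cross2_def)
  define \<Delta> where "\<Delta> = cross2 (Q - P) (R - P)"
  have \<Delta>: "\<Delta> \<noteq> 0" using nc by (simp add: noncollinear3_def \<Delta>_def)
  define \<beta> where "\<beta> = cross2 w (R - P) / \<Delta>"
  define \<gamma> where "\<gamma> = cross2 (Q - P) w / \<Delta>"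
  have w: "w = \<beta> *\<^sub>R (Q - P) + \<gamma> *\<^sub>R (R - P)"
  proof -
    have "\<Delta> * w $ 1 = \<Delta> * (\<beta> * (Q - P) $ 1 + \<gamma> * (R - P) $ 1)"
      "\<Delta> * w $ 2 = \<Delta> * (\<beta> * (Q - P) $ 2 + \<gamma> * (R - P) $ 2)"
      unfolding ring_distribs \<beta>_def \<gamma>_def using \<Delta>
      by (simp_all add: cross2_def) (simp_all add: \<Delta>_def cross2_def algebra_simps)
    then show ?thesis using \<Delta> by (simp add: vec2_eq_iff)
  qed
  have w2: "w = (- \<beta> - \<gamma>) *\<^sub>R (P - Q) + \<gamma> *\<^sub>R (R - Q)" and w3: "w = (- \<beta> - \<gamma>) *\<^sub>R (P - R) + \<beta> *\<^sub>R (Q - R)"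
    using w by (simp_all add: algebra_simps)
  have m: "- w = (- \<beta>) *\<^sub>R ((Q + w) - (P + w)) + (- \<gamma>) *\<^sub>R ((R + w) - (P + w))"
    "- w = (\<beta> + \<gamma>) *\<^sub>R ((P + w) - (Q + w)) + (- \<gamma>) *\<^sub>R ((R + w) - (Q + w))"
    "- w = (\<beta> + \<gamma>) *\<^sub>R ((P + w) - (R + w)) + (- \<beta>) *\<^sub>R ((Q + w) - (R + w))"
    using w by (simp_all add: algebra_simps)
  consider "\<beta> \<ge> 0" "\<gamma> \<ge> 0" | "- \<beta> - \<gamma> \<ge> 0" "\<gamma> \<ge> 0" | "- \<beta> - \<gamma> \<ge> 0" "\<beta> \<ge> 0"
    | "- \<beta> \<ge> 0" "- \<gamma> \<ge> 0" | "\<beta> + \<gamma> \<ge> 0" "- \<gamma> \<ge> 0" | "\<beta> + \<gamma> \<ge> 0" "- \<beta> \<ge> 0" by linarith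
  then show False
  proof cases
    case 1 show ?thesis by (rule translated_triangle_aux[OF A(1) _ _ _ _ w 1]) (use A disj ne in auto)
  next
    case 2 show ?thesis by (rule translated_triangle_aux[OF A(1) _ _ _ _ w2 2]) (use A disj ne in auto)
  next
    case 3 show ?thesis by (rule translated_triangle_aux[OF A(1) _ _ _ _ w3 3]) (use A disj ne in auto)
  next
    case 4 show ?thesis by (rule translated_triangle_aux[OF A(1) _ _ _ _ m(1) 4]) (use A disj ne in auto)
  next
    case 5 show ?thesis by (rule translated_triangle_aux[OF A(1) _ _ _ _ m(2) 5]) (use A disj ne in auto)
  next
    case 6 show ?thesis by (rule translated_triangle_aux[OF A(1) _ _ _ _ m(3) 6]) (use A disj ne in auto)
  qed
qed

section \<open>Points in convex position\<close>

text \<open>Abscissa after a shear. For generic \<open>t\<close> all points of a finite set get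
  distinct abscissas, so every connecting line has a finite slope.\<close>

definition shear_x :: "real \<Rightarrow> real ^ 2 \<Rightarrow> real" where
  "shear_x t p = p $ 1 + t * p $ 2"

definition slope :: "real \<Rightarrow> real ^ 2 \<Rightarrow> real ^ 2 \<Rightarrow> real" where
  "slope t p q = (q $ 2 - p $ 2) / (shear_x t q - shear_x t p)"

definition on_or_above :: "real \<Rightarrow> real ^ 2 \<Rightarrow> real ^ 2 \<Rightarrow> real ^ 2 \<Rightarrow> bool" where
  "on_or_above t p r q \<longleftrightarrow> p $ 2 + slope t p r * (shear_x t q - shear_x t p) \<le> q $ 2"

definition extreme_points :: "real \<Rightarrow> (real ^ 2) set \<Rightarrow> real ^ 2 \<Rightarrow> real ^ 2 \<Rightarrow> bool" where
  "extreme_points t A l r \<longleftrightarrow> l \<in> A \<and> r \<in> A \<and> (\<forall>p\<in>A. shear_x t l \<le> shear_x t p \<and> shear_x t p \<le> shear_x t r)"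

lemma slope_commute: "slope t p q = slope t q p"
  unfolding slope_def by (metis minus_diff_eq minus_divide_divide)

text \<open>Two distinct points collide for exactly one \<open>t\<close> if their second coordinates
  differ, and for none otherwise.\<close>

lemma ex_injective_shear:
  assumes "finite A"
  shows "\<exists>t. inj_on (shear_x t) A"
proof -
  define B where "B = (\<lambda>(p, q). - (p $ 1 - q $ 1) / (p $ 2 - q $ 2)) ` (A \<times> A)"
  have "finite B" using assms by (simp add: B_def)
  then obtain t where t: "t \<notin> B" using ex_new_if_finite infinite_UNIV_char_0 by blast
  have "inj_on (shear_x t) A"
  proof (rule inj_onI)
    fix p q assume pq: "p \<in> A" "q \<in> A" "shear_x t p = shear_x t q"
    then have e: "t * (p $ 2 - q $ 2) = - (p $ 1 - q $ 1)" by (simp add: shear_x_def algebra_simps)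
    show "p = q"
    proof (cases "p $ 2 = q $ 2")
      case True then show ?thesis using e by (simp add: vec2_eq_iff)
    next
      case False
      then have "t = - (p $ 1 - q $ 1) / (p $ 2 - q $ 2)" using e by (simp add: eq_divide_eq)
      then have "t \<in> B" using pq unfolding B_def by force
      then show ?thesis using t by simp
    qed
  qed
  then show ?thesis ..
qed

lemma slope_eq_imp_cross2:
  assumes "slope t p q = slope t p' q'" "shear_x t p \<noteq> shear_x t q" "shear_x t p' \<noteq> shear_x t q'"
  shows "cross2 (p - q) (p' - q') = 0"
proof -
  have "(q $ 2 - p $ 2) * (shear_x t q' - shear_x t p') = (q' $ 2 - p' $ 2) * (shear_x t q - shear_x t p)"
    using assms unfolding slope_def by (simp add: frac_eq_eq)
  then show ?thesis by (simp add: cross2_def shear_x_def algebra_simps)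
qed

text \<open>The slope is a function of the direction: any nonzero vector of the subspace reveals it.
  Finiteness of \<open>E\<close> prevents \<open>directions E\<close> from being infinite and so
  having \<open>card\<close> zero.\<close>

lemma card_slopes_le:
  assumes "finite E" "F \<subseteq> E" "\<And>p q. (p, q) \<in> F \<Longrightarrow> p \<noteq> q"
  shows "card ((\<lambda>(p, q). slope t p q) ` F) \<le> card (directions E)"
proof -
  define h where "h V = (let v = (SOME v. v \<in> V \<and> v \<noteq> 0) in v $ 2 / shear_x t v)" for V :: "(real ^ 2) set"
  have "h (direction p q) = slope t p q" if "p \<noteq> q" for p q
  proof -
    have "\<exists>v. v \<in> direction p q \<and> v \<noteq> 0"
      using that unfolding direction_def by (intro exI[of _ "q - p"]) (auto intro: span_base)
    from someI_ex[OF this] obtain v where v: "v \<in> direction p q" "v \<noteq> 0"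
      "h (direction p q) = v $ 2 / shear_x t v" by (auto simp: h_def Let_def)
    obtain k where k: "v = k *\<^sub>R (q - p)" using v(1) unfolding direction_def by (auto simp: span_singleton)
    then have "k \<noteq> 0" using v(2) by auto
    have "shear_x t v = k * (shear_x t q - shear_x t p)" "v $ 2 = k * (q $ 2 - p $ 2)"
      unfolding k by (simp_all add: shear_x_def algebra_simps)
    then show ?thesis using v(3) \<open>k \<noteq> 0\<close> by (simp add: slope_def)
  qed
  note h = this
  have "(\<lambda>(p, q). slope t p q) ` F \<subseteq> h ` directions E"
  proof
    fix s assume "s \<in> (\<lambda>(p, q). slope t p q) ` F"
    then obtain p q where pq: "(p, q) \<in> F" "s = slope t p q" by auto
    then have "direction p q \<in> directions E" using assms(2,3) unfolding directions_def by blast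
    then show "s \<in> h ` directions E" using h[OF assms(3)[OF pq(1)]] pq(2) by (metis imageI)
  qed
  moreover have "directions E \<subseteq> (\<lambda>(p, q). direction p q) ` E" unfolding directions_def by auto
  then have "finite (directions E)" using assms(1) finite_subset by blast
  ultimately show ?thesis by (meson card_image_le card_mono finite_imageI order_trans)
qed

lemma hull_point_on_vertical:
  assumes "p \<in> A" "r \<in> A" "shear_x t p < x" "x < shear_x t r" "p \<noteq> q" "r \<noteq> q"
  shows "\<exists>z. z \<in> convex hull (A - {q}) \<and> shear_x t z = x \<and> z $ 2 = p $ 2 + slope t p r * (x - shear_x t p)"
proof -
  define \<theta> where "\<theta> = (x - shear_x t p) / (shear_x t r - shear_x t p)"
  have \<theta>: "0 \<le> \<theta>" "\<theta> \<le> 1" using assms by (auto simp: \<theta>_def)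
  define z where "z = (1 - \<theta>) *\<^sub>R p + \<theta> *\<^sub>R r"
  have "p \<in> convex hull (A - {q})" "r \<in> convex hull (A - {q})" using assms by (auto intro!: hull_inc)
  then have "z \<in> convex hull (A - {q})"
    unfolding z_def using \<theta> by (intro convexD[OF convex_convex_hull]) auto
  moreover have "shear_x t z = shear_x t p + \<theta> * (shear_x t r - shear_x t p)"
    by (simp add: z_def shear_x_def algebra_simps)
  then have "shear_x t z = x" using assms by (simp add: \<theta>_def)
  moreover have "z $ 2 = p $ 2 + \<theta> * (r $ 2 - p $ 2)" by (simp add: z_def algebra_simps)
  then have "z $ 2 = p $ 2 + slope t p r * (x - shear_x t p)" by (simp add: \<theta>_def slope_def)
  ultimately show ?thesis by blast
qed

text \<open>On the vertical line through \<open>q\<close>, one chord of other points passes below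
  and one above, which puts \<open>q\<close> into the hull of the rest. As both inequalities are
  weak, a single chord through \<open>q\<close> may play both roles.\<close>

lemma convex_position_not_between:
  assumes A: "convex_position A" and q: "q \<in> A"
    and pr: "p \<in> A" "r \<in> A" "shear_x t p < shear_x t q" "shear_x t q < shear_x t r"
    and pr': "p' \<in> A" "r' \<in> A" "shear_x t p' < shear_x t q" "shear_x t q < shear_x t r'"
    and le: "p $ 2 + slope t p r * (shear_x t q - shear_x t p) \<le> q $ 2"
      "q $ 2 \<le> p' $ 2 + slope t p' r' * (shear_x t q - shear_x t p')"
  shows False
proof -
  obtain z where z: "z \<in> convex hull (A - {q})" "shear_x t z = shear_x t q" "z $ 2 \<le> q $ 2"
    using hull_point_on_vertical[OF pr, of q] pr le by (metis order_less_irrefl)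
  obtain z' where z': "z' \<in> convex hull (A - {q})" "shear_x t z' = shear_x t q" "q $ 2 \<le> z' $ 2"
    using hull_point_on_vertical[OF pr', of q] pr' le by (metis order_less_irrefl)
  \<comment> \<open>The default 0 covers the case where both chords pass through \<open>q\<close>
    itself.\<close>
  define \<mu> where "\<mu> = (if z' $ 2 = z $ 2 then 0 else (q $ 2 - z $ 2) / (z' $ 2 - z $ 2))"
  have \<mu>: "0 \<le> \<mu>" "\<mu> \<le> 1" using z z' by (auto simp: \<mu>_def divide_simps)
  have y: "q $ 2 = (1 - \<mu>) * z $ 2 + \<mu> * z' $ 2"
  proof (cases "z' $ 2 = z $ 2")
    case True then show ?thesis using z z' by (simp add: \<mu>_def)
  next
    case False
    then have "\<mu> * (z' $ 2 - z $ 2) = q $ 2 - z $ 2" by (simp add: \<mu>_def)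
    then show ?thesis by (simp add: algebra_simps)
  qed
  have x: "z $ 1 = q $ 1 + t * (q $ 2 - z $ 2)" "z' $ 1 = q $ 1 + t * (q $ 2 - z' $ 2)"
    using z z' by (simp_all add: shear_x_def algebra_simps)
  have "(1 - \<mu>) * z $ 1 + \<mu> * z' $ 1 = q $ 1 + t * (q $ 2 - ((1 - \<mu>) * z $ 2 + \<mu> * z' $ 2))"
    unfolding x by (simp add: algebra_simps)
  then have "q = (1 - \<mu>) *\<^sub>R z + \<mu> *\<^sub>R z'" using y by (simp add: vec2_eq_iff)
  also have "\<dots> \<in> convex hull (A - {q})"
    using z z' \<mu> by (intro convexD[OF convex_convex_hull]) auto
  finally show False using A q unfolding convex_position_def by blast
qed

text \<open>The point with the middle abscissa would lie on the chord of the other two, which then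
  bounds it from both sides.\<close>

lemma convex_position_noncollinear3:
  assumes A: "convex_position A" "finite A" and pqr: "p \<in> A" "q \<in> A" "r \<in> A" "p \<noteq> q" "p \<noteq> r" "q \<noteq> r"
  shows "noncollinear3 p q r"
proof (rule ccontr)
  assume "\<not> noncollinear3 p q r"
  then have c: "cross2 (q - p) (r - p) = 0" by (simp add: noncollinear3_def)
  obtain t where t: "inj_on (shear_x t) A" using ex_injective_shear[OF A(2)] by blast
  have mid: False if "p \<in> A" "q \<in> A" "r \<in> A" "shear_x t p < shear_x t q" "shear_x t q < shear_x t r"
    "cross2 (q - p) (r - p) = 0" for p q r
  proof -
    have "(q $ 2 - p $ 2) * (shear_x t r - shear_x t p) = (r $ 2 - p $ 2) * (shear_x t q - shear_x t p)"
      using that(6) by (simp add: cross2_def shear_x_def algebra_simps)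
    then have "q $ 2 = p $ 2 + slope t p r * (shear_x t q - shear_x t p)"
      using that(4,5) by (simp add: slope_def field_simps)
    then show False using convex_position_not_between[OF A(1) that(2,1,3,4,5) that(1,3,4,5)] by simp
  qed
  have "shear_x t p \<noteq> shear_x t q" "shear_x t p \<noteq> shear_x t r" "shear_x t q \<noteq> shear_x t r"
    using t pqr by (auto simp: inj_on_def)
  moreover have "cross2 (r - p) (q - p) = 0" "cross2 (p - q) (r - q) = 0" "cross2 (r - q) (p - q) = 0"
    "cross2 (p - r) (q - r) = 0" "cross2 (q - r) (p - r) = 0"
    using c by (simp_all add: cross2_def algebra_simps)
  ultimately show False using mid pqr c by (metis linorder_neqE_linordered_idom)
qed

text \<open>If \<open>q\<close> is on or above the chord \<open>l u\<close>, no chord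
  \<open>p r\<close> can pass on or above \<open>q\<close>, so \<open>q\<close> is strictly above
  \<open>p r\<close>; the other case is symmetric. Only the side of the middle point matters, so
  arcs on different sides can be combined.\<close>

lemma slope_middle:
  assumes A: "convex_position A" and ext: "extreme_points t A l u"
    and pqr: "p \<in> A" "q \<in> A" "r \<in> A" "shear_x t p < shear_x t q" "shear_x t q < shear_x t r"
  shows "on_or_above t l u q \<Longrightarrow> slope t q r < slope t p r \<and> slope t p r < slope t p q"
    and "\<not> on_or_above t l u q \<Longrightarrow> slope t p q < slope t p r \<and> slope t p r < slope t q r"
proof -
  have lu: "l \<in> A" "u \<in> A" "shear_x t l < shear_x t q" "shear_x t q < shear_x t u"
    using ext pqr unfolding extreme_points_def by force+
  define s where "s = slope t p r"
  have r: "r $ 2 = p $ 2 + s * (shear_x t r - shear_x t p)" using pqr by (simp add: s_def slope_def)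
  have pq: "slope t p q = (q $ 2 - p $ 2) / (shear_x t q - shear_x t p)"
    and qr: "slope t q r = (r $ 2 - q $ 2) / (shear_x t r - shear_x t q)" by (simp_all add: slope_def)
  show "slope t q r < slope t p r \<and> slope t p r < slope t p q" if "on_or_above t l u q"
  proof -
    have "q $ 2 > p $ 2 + s * (shear_x t q - shear_x t p)"
      using convex_position_not_between[OF A pqr(2) lu pqr(1,3,4,5)] that
      unfolding on_or_above_def s_def by (metis not_less)
    then show ?thesis
      unfolding pq qr s_def[symmetric] r using pqr(4,5) by (simp add: divide_less_eq less_divide_eq algebra_simps)
  qed
  show "slope t p q < slope t p r \<and> slope t p r < slope t q r" if "\<not> on_or_above t l u q"
  proof -
    have "q $ 2 < p $ 2 + s * (shear_x t q - shear_x t p)"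
      using convex_position_not_between[OF A pqr(2) pqr(1,3,4,5) lu] that
      unfolding on_or_above_def s_def by (metis not_less order_less_imp_le)
    then show ?thesis
      unfolding pq qr s_def[symmetric] r using pqr(4,5) by (simp add: divide_less_eq less_divide_eq algebra_simps)
  qed
qed

lemma ex_sorted_enumeration:
  fixes key :: "'a \<Rightarrow> real"
  assumes "finite P" "inj_on key P"
  shows "\<exists>a. bij_betw a {..<card P} P \<and> (\<forall>i j. i < j \<longrightarrow> j < card P \<longrightarrow> key (a i) < key (a j))"
proof -
  define l where "l = sorted_list_of_set (key ` P)"
  have l: "sorted l" "distinct l" "set l = key ` P" "length l = card P"
    using assms by (simp_all add: l_def card_image)
  define a where "a i = the_inv_into P key (l ! i)" for i
  have key: "key (a i) = l ! i \<and> a i \<in> P" if "i < card P" for i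
  proof -
    have "l ! i \<in> key ` P" using l that nth_mem by metis
    then show ?thesis unfolding a_def using assms(2) f_the_inv_into_f the_inv_into_into by fastforce
  qed
  have less: "key (a i) < key (a j)" if "i < j" "j < card P" for i j
  proof -
    have "l ! i \<le> l ! j" using l that by (intro sorted_nth_mono) auto
    moreover have "l ! i \<noteq> l ! j" using l that by (simp add: nth_eq_iff_index_eq)
    ultimately show ?thesis using key that by simp
  qed
  have "inj_on a {..<card P}"
    by (rule inj_onI) (metis lessThan_iff less linorder_neqE_nat less_irrefl)
  moreover have "a ` {..<card P} \<subseteq> P" using key by auto
  ultimately have "bij_betw a {..<card P} P"
    by (simp add: bij_betw_def card_image card_subset_eq assms(1))
  then show ?thesis using less by blast
qed

section \<open>Gluing the conics of the blocks\<close>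

text \<open>Cauchy-Schwarz for the column degrees bounds below the pairs of an edge and a row
  adjacent to its column; some row \<open>u0\<close> reaches the average. The conic of
  \<open>(u, v)\<close> can then be compared with that of \<open>(u0, v)\<close> through column
  \<open>v\<close>, and with every other one in row \<open>u0\<close>.\<close>

lemma dense_star:
  assumes W: "W \<subseteq> {..<U} \<times> {..<U}" and dense: "real (card W) \<ge> g * (real U)\<^sup>2" and "U > 0" "g \<ge> 0"
  shows "\<exists>u0. real (card {w\<in>W. (u0, snd w) \<in> W}) \<ge> g\<^sup>2 * (real U)\<^sup>2"
proof (rule ccontr)
  assume "\<not> ?thesis"
  then have lt: "real (card {w\<in>W. (u, snd w) \<in> W}) < g\<^sup>2 * (real U)\<^sup>2" for u by (meson not_less)
  have fW: "finite W" using W finite_subset by blast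
  define d where "d v = real (card {w\<in>W. snd w = v})" for v
  have im: "snd ` W \<subseteq> {..<U}" using W by auto
  have "real (card W) = (\<Sum>v<U. d v)"
    using sum.group[OF fW _ im, of "\<lambda>_. 1::real"] by (simp add: d_def)
  then have "(real (card W))\<^sup>2 \<le> real U * (\<Sum>v<U. (d v)\<^sup>2)"
    using sum_squared_le_sum_of_squares[of d "{..<U}"] by (simp add: mult.commute)
  also have "(\<Sum>v<U. (d v)\<^sup>2) = (\<Sum>v<U. \<Sum>w\<in>{w\<in>W. snd w = v}. d (snd w))"
    by (intro sum.cong refl) (simp add: d_def power2_eq_square)
  also have "\<dots> = (\<Sum>w\<in>W. d (snd w))" using sum.group[OF fW _ im, of "\<lambda>w. d (snd w)"] by simp
  also have "\<dots> = (\<Sum>w\<in>W. \<Sum>u<U. of_bool ((u, snd w) \<in> W))"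
  proof (rule sum.cong[OF refl])
    fix w
    have "card {w'\<in>W. snd w' = snd w} = card {u\<in>{..<U}. (u, snd w) \<in> W}"
      by (rule bij_betw_same_card[of fst])
        (use W in \<open>auto simp: bij_betw_def inj_on_def prod_eq_iff image_iff intro!: bexI[of _ "(_, snd w)"]\<close>)
    then show "d (snd w) = (\<Sum>u<U. of_bool ((u, snd w) \<in> W))"
      by (simp add: d_def sum.If_cases Int_def of_bool_def)
  qed
  also have "\<dots> = (\<Sum>u<U. real (card {w\<in>W. (u, snd w) \<in> W}))"
    using fW by (subst sum.swap) (simp add: sum.If_cases Int_def of_bool_def)
  also have "real U * \<dots> < real U * (\<Sum>u<U. g\<^sup>2 * (real U)\<^sup>2)"
    using lt \<open>U > 0\<close> by (intro mult_strict_left_mono sum_strict_mono) auto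
  also have "\<dots> = (g * (real U)\<^sup>2)\<^sup>2" by (simp add: power2_eq_square algebra_simps)
  also have "\<dots> \<le> (real (card W))\<^sup>2" using dense \<open>g \<ge> 0\<close> by (intro power_mono) auto
  finally show False by simp
qed

text \<open>Interface between geometry and combinatorics: \<open>a\<close> and \<open>b\<close>
  number points of two arcs, and \<open>g\<close> abstracts their slopes, of which only monotonicity
  and the meaning of equal values are retained.\<close>

definition slope_grid ::
  "nat \<Rightarrow> (real ^ 2) set \<Rightarrow> (nat \<Rightarrow> real ^ 2) \<Rightarrow> (nat \<Rightarrow> real ^ 2) \<Rightarrow> nat \<Rightarrow> nat \<Rightarrow> (nat \<Rightarrow> nat \<Rightarrow> real) \<Rightarrow>
    (nat \<times> nat) set \<Rightarrow> bool" where
  "slope_grid n A a b p q g E \<longleftrightarrow> finite A \<and> convex_position A \<and> p \<le> n \<and> q \<le> n \<and>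
     inj_on a {..<p} \<and> inj_on b {..<q} \<and> a ` {..<p} \<subseteq> A \<and> b ` {..<q} \<subseteq> A \<and> a ` {..<p} \<inter> b ` {..<q} = {} \<and>
     E \<subseteq> {..<p} \<times> {..<q} \<and>
     (\<forall>i i' j. i < i' \<longrightarrow> i' < p \<longrightarrow> j < q \<longrightarrow> g i j < g i' j) \<and>
     (\<forall>i j j'. j < j' \<longrightarrow> i < p \<longrightarrow> j' < q \<longrightarrow> g i j < g i j') \<and>
     (\<forall>i j i' j'. (i, j) \<in> E \<longrightarrow> (i', j') \<in> E \<longrightarrow> g i j = g i' j' \<longrightarrow> cross2 (a i - b j) (a i' - b j') = 0)"

text \<open>
  The value \<open>f i j\<close> is the rank of the slope \<open>g i j\<close> among the slopes occurring in \<open>E\<close>; truncating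
  the indices makes it monotone on all of \<open>\<nat> \<times> \<nat>\<close>.
\<close>
lemma slope_grid_ranks:
  assumes grid: "slope_grid n A a b p q g E" and ne: "E \<noteq> {}"
  defines "S \<equiv> (\<lambda>(i, j). g i j) ` E"
  defines "f \<equiv> \<lambda>i j. card {s\<in>S. s < g (min i (p - 1)) (min j (q - 1))}"
  shows "monotone_grid n (card S) f E"
    and "\<And>i j i' j'. (i, j) \<in> E \<Longrightarrow> (i', j') \<in> E \<Longrightarrow> f i j = f i' j' \<Longrightarrow> g i j = g i' j'"
proof -
  have pq: "p \<le> n" "q \<le> n" and E: "E \<subseteq> {..<p} \<times> {..<q}"
    and m1: "\<And>i i' j. i < i' \<Longrightarrow> i' < p \<Longrightarrow> j < q \<Longrightarrow> g i j < g i' j"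
    and m2: "\<And>i j j'. j < j' \<Longrightarrow> i < p \<Longrightarrow> j' < q \<Longrightarrow> g i j < g i j'"
    using grid unfolding slope_grid_def by blast+
  have pos: "p > 0" "q > 0" using ne E by auto
  have finE: "finite E" using E finite_subset by blast
  then have finS: "finite S" by (simp add: S_def)
  have strict: "g i j = g i' j'" if e: "(i, j) \<in> E" "(i', j') \<in> E" and eq: "f i j = f i' j'" for i j i' j'
  proof -
    have f: "f i j = card {s\<in>S. s < g i j}" if "(i, j) \<in> E" for i j
    proof -
      have "i < p" "j < q" using E that by auto
      then have "min i (p - 1) = i" "min j (q - 1) = j" by auto
      then show ?thesis by (simp add: f_def)
    qed
    have lt: "card {s\<in>S. s < g i j} < card {s\<in>S. s < g i' j'}" if "(i, j) \<in> E" "g i j < g i' j'" for i j i' j'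
    proof (rule psubset_card_mono)
      have "g i j \<in> S" using that(1) unfolding S_def by force
      then show "{s\<in>S. s < g i j} \<subset> {s\<in>S. s < g i' j'}" using that(2) by force
    qed (use finS in simp)
    have "card {s\<in>S. s < g i j} = card {s\<in>S. s < g i' j'}" using eq f[OF e(1)] f[OF e(2)] by simp
    then show ?thesis using lt[OF e(1), of i' j'] lt[OF e(2), of i j] by linarith
  qed
  then show "\<And>i j i' j'. (i, j) \<in> E \<Longrightarrow> (i', j') \<in> E \<Longrightarrow> f i j = f i' j' \<Longrightarrow> g i j = g i' j'" .
  have w1: "g i j \<le> g i' j" if "i \<le> i'" "i' < p" "j < q" for i i' j
    using that m1[of i i' j] by (cases "i = i'") (simp_all add: less_imp_le)
  have w2: "g i j \<le> g i j'" if "j \<le> j'" "i < p" "j' < q" for i j j'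
    using that m2[of j j' i] by (cases "j = j'") (simp_all add: less_imp_le)
  show "monotone_grid n (card S) f E"
    unfolding monotone_grid_def
  proof (intro conjI allI impI)
    show "E \<subseteq> {..<n} \<times> {..<n}" using E pq by fastforce
    show "f i j \<le> f i' j'" if "i \<le> i'" "j \<le> j'" for i i' j j'
    proof -
      have "g (min i (p - 1)) (min j (q - 1)) \<le> g (min i' (p - 1)) (min j (q - 1))"
        using that pos by (intro w1) auto
      also have "\<dots> \<le> g (min i' (p - 1)) (min j' (q - 1))"
        using that pos by (intro w2) auto
      finally show ?thesis unfolding f_def using finS by (intro card_mono) auto
    qed
    show "f i j \<le> card S" for i j unfolding f_def using finS by (intro card_mono) auto
  next
    fix i i' j assume e: "(i, j) \<in> E" "(i', j) \<in> E" "f i j = f i' j"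
    then have "g i j = g i' j" using strict by blast
    moreover have "i < p" "i' < p" "j < q" using e E by auto
    ultimately show "i = i'" using m1[of i i' j] m1[of i' i j] by (cases i i' rule: linorder_cases) auto
  next
    fix i j j' assume e: "(i, j) \<in> E" "(i, j') \<in> E" "f i j = f i j'"
    then have "g i j = g i j'" using strict by blast
    moreover have "j < q" "j' < q" "i < p" using e E by auto
    ultimately show "j = j'" using m2[of j j' i] m2[of j' j i] by (cases j j' rule: linorder_cases) auto
  qed
qed

text \<open>The constant \<open>(\<gamma> / 2)\<^sup>2 / m\<^sup>2\<close> collects the losses: half
  of the density is reserved for centrally symmetric block pairs, \<open>dense_star\<close> squares
  the rest, and each surviving block pair contributes a single pair of points.\<close>

lemma slope_grid_conic:
  fixes c D :: real
  assumes cD: "c > 0" "D > 0"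
  shows "\<exists>\<delta>>0. \<exists>n0. \<forall>n\<ge>n0. \<forall>A a b p q g E. slope_grid n A a b p q g E \<longrightarrow>
    real (card ((\<lambda>(i, j). g i j) ` E)) \<le> D * real n \<longrightarrow> real (card E) \<ge> c * (real n)\<^sup>2 \<longrightarrow>
    (\<exists>H C. H \<subseteq> E \<and> real (card H) \<ge> \<delta> * (real n)\<^sup>2 \<and> is_conic C \<and> (\<forall>i j. (i, j) \<in> H \<longrightarrow> a i \<in> C \<and> b j \<in> C))"
proof -
  have f5: "config_forced 5" by (rule config_forced) simp
  obtain m \<gamma> n1 where m: "m > 0" and \<gamma>: "\<gamma> > 0" and pop: "\<And>n N f E. n \<ge> n1 \<Longrightarrow> monotone_grid n N f E \<Longrightarrow>
     real N \<le> D * real n \<Longrightarrow> real (card E) \<ge> c * (real n)\<^sup>2 \<Longrightarrow> recurrent_config 5 m \<gamma> (n div m + 1) E f"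
    using popular_pattern[OF f5 zero_less_numeral cD] by blast
  \<comment> \<open>At most \<open>U\<close> block pairs are centrally symmetric, and this is at
    most \<open>\<gamma> / 2 * U\<^sup>2\<close> once \<open>U \<ge> 2 / \<gamma>\<close>.\<close>
  obtain n2 :: nat where n2: "2 / \<gamma> < real n2" using reals_Archimedean2 by blast
  define \<delta> where "\<delta> = (\<gamma> / 2)\<^sup>2 / (real m)\<^sup>2"
  have \<delta>: "\<delta> > 0" using \<gamma> m by (simp add: \<delta>_def)
  have main: "\<exists>H C. H \<subseteq> E \<and> real (card H) \<ge> \<delta> * (real n)\<^sup>2 \<and> is_conic C \<and> (\<forall>i j. (i, j) \<in> H \<longrightarrow> a i \<in> C \<and> b j \<in> C)"
    if n: "n \<ge> max (max n1 (n2 * m)) 1" and grid: "slope_grid n A a b p q g E"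
      and few: "real (card ((\<lambda>(i, j). g i j) ` E)) \<le> D * real n" and dense: "real (card E) \<ge> c * (real n)\<^sup>2"
    for n A a b p q g E
  proof -
    define U where "U = n div m + 1"
    have nU: "n \<le> U * m"
      unfolding U_def by (metis add.commute add_mult_distrib dividend_less_times_div less_or_eq_imp_le mult.commute mult_1 m)
    have U: "U \<ge> n2" "U > 0"
    proof -
      have "n2 * m div m \<le> n div m" using n by (intro div_le_mono) auto
      then show "U \<ge> n2" "U > 0" using m by (simp_all add: U_def)
    qed
    have A: "finite A" "convex_position A" and inj: "inj_on a {..<p}" "inj_on b {..<q}"
      and sub0: "a ` {..<p} \<subseteq> A" "b ` {..<q} \<subseteq> A"
      and disj: "a ` {..<p} \<inter> b ` {..<q} = {}" and E: "E \<subseteq> {..<p} \<times> {..<q}"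
      and par0: "\<forall>i j i' j'. (i, j) \<in> E \<longrightarrow> (i', j') \<in> E \<longrightarrow> g i j = g i' j' \<longrightarrow> cross2 (a i - b j) (a i' - b j') = 0"
      using grid unfolding slope_grid_def by argo+
    have sub: "a i \<in> A" if "i < p" for i using sub0(1) that by auto
    have sub': "b j \<in> A" if "j < q" for j using sub0(2) that by auto
    have par: "cross2 (a i - b j) (a i' - b j') = 0"
      if "(i, j) \<in> E" "(i', j') \<in> E" "g i j = g i' j'" for i j i' j'
      using par0 that by blast
    have "c * (real n)\<^sup>2 > 0" using cD n by simp
    then have "E \<noteq> {}" using dense by auto
    define f where "f = (\<lambda>i j. card {s\<in>(\<lambda>(i, j). g i j) ` E. s < g (min i (p - 1)) (min j (q - 1))})"
    have f: "monotone_grid n (card ((\<lambda>(i, j). g i j) ` E)) f E"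
      "\<And>i j i' j'. (i, j) \<in> E \<Longrightarrow> (i', j') \<in> E \<Longrightarrow> f i j = f i' j' \<Longrightarrow> g i j = g i' j'"
      using slope_grid_ranks[OF grid \<open>E \<noteq> {}\<close>] unfolding f_def by blast+
    have "recurrent_config 5 m \<gamma> U E f" using pop[OF _ f(1) few dense] n by (simp add: U_def)
    then obtain \<sigma> \<rho> W where W: "W \<subseteq> {..<U} \<times> {..<U}" "real (card W) \<ge> \<gamma> * (real U)\<^sup>2"
      and bd: "\<And>i. i < 5 \<Longrightarrow> \<sigma> i < m \<and> \<rho> i < m"
      and conf: "\<And>u v. (u, v) \<in> W \<Longrightarrow> symmetric_config 5 E f (\<lambda>i. u * m + \<sigma> i) (\<lambda>j. v * m + \<rho> j)"
      unfolding recurrent_config_def by blast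
    have finW: "finite W" using W(1) finite_subset by blast
    have far: "x * m + s \<noteq> y * m + t" if "x \<noteq> y" "s < m" "t < m" for x y s t
    proof
      assume "x * m + s = y * m + t"
      then have "(x * m + s) div m = (y * m + t) div m" by simp
      then show False using that by simp
    qed
    define \<alpha> where "\<alpha> u i = a (u * m + \<sigma> i)" for u i
    define \<beta> where "\<beta> v i = b (v * m + \<rho> i)" for v i
    have E0: "(u * m + \<sigma> 0, v * m + \<rho> 0) \<in> E" if "(u, v) \<in> W" for u v
      using conf[OF that] unfolding symmetric_config_def by blast
    have Eij: "(u * m + \<sigma> i, v * m + \<rho> j) \<in> E" "f (u * m + \<sigma> i) (v * m + \<rho> j) = f (u * m + \<sigma> j) (v * m + \<rho> i)"
      if "(u, v) \<in> W" "i < 5" "j < 5" "i \<noteq> j" for u v i j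
      using conf[OF that(1)] that(2-) unfolding symmetric_config_def by blast+
    have idx: "u * m + \<sigma> i < p" "v * m + \<rho> i < q" if uv: "(u, v) \<in> W" and i: "i < 5" for u v i
    proof -
      define j :: nat where "j = (if i = 0 then 1 else 0)"
      have j: "j < 5" "i \<noteq> j" by (auto simp: j_def)
      show "u * m + \<sigma> i < p" "v * m + \<rho> i < q"
        using Eij(1)[OF uv i j] Eij(1)[OF uv j(1) i j(2)[symmetric]] E by auto
    qed
    have injx: "inj_on (\<lambda>i. u * m + \<sigma> i) {..<5}" "inj_on (\<lambda>i. v * m + \<rho> i) {..<5}" if "(u, v) \<in> W" for u v
      using conf[OF that] unfolding symmetric_config_def by blast+
    have nca: "noncollinear3 (\<alpha> u i) (\<alpha> u j) (\<alpha> u k)" and ncb: "noncollinear3 (\<beta> v i) (\<beta> v j) (\<beta> v k)"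
      if "(u, v) \<in> W" "i < 5" "j < 5" "k < 5" "i \<noteq> j" "i \<noteq> k" "j \<noteq> k" for u v i j k
    proof -
      have "\<alpha> u i \<noteq> \<alpha> u j" if ij: "i < 5" "j < 5" "i \<noteq> j" for i j
      proof
        assume "\<alpha> u i = \<alpha> u j"
        then have "u * m + \<sigma> i = u * m + \<sigma> j"
          using inj_onD[OF inj(1), of "u * m + \<sigma> i" "u * m + \<sigma> j"] idx(1)[OF \<open>(u, v) \<in> W\<close>] ij by (simp add: \<alpha>_def)
        then show False using inj_onD[OF injx(1)[OF \<open>(u, v) \<in> W\<close>]] ij by blast
      qed
      then show "noncollinear3 (\<alpha> u i) (\<alpha> u j) (\<alpha> u k)"
        using that idx by (intro convex_position_noncollinear3[OF A(2,1)]) (auto simp: \<alpha>_def intro!: sub sub')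
      have "\<beta> v i \<noteq> \<beta> v j" if ij: "i < 5" "j < 5" "i \<noteq> j" for i j
      proof
        assume "\<beta> v i = \<beta> v j"
        then have "v * m + \<rho> i = v * m + \<rho> j"
          using inj_onD[OF inj(2), of "v * m + \<rho> i" "v * m + \<rho> j"] idx(2)[OF \<open>(u, v) \<in> W\<close>] ij by (simp add: \<beta>_def)
        then show False using inj_onD[OF injx(2)[OF \<open>(u, v) \<in> W\<close>]] ij by blast
      qed
      then show "noncollinear3 (\<beta> v i) (\<beta> v j) (\<beta> v k)"
        using that idx by (intro convex_position_noncollinear3[OF A(2,1)]) (auto simp: \<beta>_def intro!: sub sub')
    qed
    define anti where "anti = {(u, v). (u, v) \<in> W \<and> (\<exists>t. \<forall>i<5. \<beta> v i = t - \<alpha> u i)}"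
    have dich: "(u, v) \<in> anti \<or> (\<exists>C. is_conic C \<and> (\<forall>i<5. \<alpha> u i \<in> C \<and> \<beta> v i \<in> C))" if W: "(u, v) \<in> W" for u v
    proof -
      have "cross2 (\<alpha> u i - \<beta> v j) (\<alpha> u j - \<beta> v i) = 0" if "i < 5" "j < 5" "i \<noteq> j" for i j
      proof -
        have e: "(u * m + \<sigma> i, v * m + \<rho> j) \<in> E" "(u * m + \<sigma> j, v * m + \<rho> i) \<in> E"
          using Eij(1)[OF W that] Eij(1)[OF W that(2,1) that(3)[symmetric]] by blast+
        show ?thesis unfolding \<alpha>_def \<beta>_def by (rule par[OF e f(2)[OF e Eij(2)[OF W that]]])
      qed
      moreover have "\<alpha> u 0 \<noteq> \<beta> v 0" using disj idx[OF W, of 0] unfolding \<alpha>_def \<beta>_def by auto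
      ultimately have "(\<exists>t. \<forall>i<5. \<beta> v i = t - \<alpha> u i) \<or> (\<exists>C. is_conic C \<and> (\<forall>i<5. \<alpha> u i \<in> C \<and> \<beta> v i \<in> C))"
        by (intro symmetric_config_conic nca[OF W]) auto
      then show ?thesis using W by (auto simp: anti_def)
    qed
    have "inj_on fst anti"
    proof (rule inj_onI)
      fix w w' assume w: "w \<in> anti" "w' \<in> anti" "fst w = fst w'"
      obtain u v v' where ww: "w = (u, v)" "w' = (u, v')" using w(3) by (metis prod.collapse)
      obtain t t' where t: "\<forall>i<5. \<beta> v i = t - \<alpha> u i" "\<forall>i<5. \<beta> v' i = t' - \<alpha> u i"
        and WW: "(u, v) \<in> W" "(u, v') \<in> W" using w ww by (auto simp: anti_def)
      have tr: "\<beta> v i + (t' - t) = \<beta> v' i" if "i < 5" for i using t that by simp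
      show "w = w'"
      proof (rule ccontr)
        assume "w \<noteq> w'"
        then have "v \<noteq> v'" using ww by simp
        have ne: "\<beta> v i \<noteq> \<beta> v' j" if "i < 5" "j < 5" for i j
          using inj_onD[OF inj(2), of "v * m + \<rho> i" "v' * m + \<rho> j"] far[OF \<open>v \<noteq> v'\<close>] bd
            idx(2)[OF WW(1)] idx(2)[OF WW(2)] that unfolding \<beta>_def by auto
        have mem: "\<beta> v i \<in> A" "\<beta> v' i \<in> A" if "i < 5" for i
          using idx(2)[OF WW(1)] idx(2)[OF WW(2)] that by (auto simp: \<beta>_def intro!: sub sub')
        show False
          by (rule no_translated_triangle[OF A(2), of "\<beta> v 0" "\<beta> v 1" "\<beta> v 2" "t' - t"])
            (use mem ne ne[symmetric] ncb[OF WW(1), of 0 1 2] in \<open>simp_all add: tr\<close>)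
      qed
    qed
    then have "card anti \<le> card {..<U}" using W(1) by (intro card_inj_on_le) (auto simp: anti_def)
    moreover have "2 / \<gamma> \<le> real U" using n2 U by linarith
    then have "2 \<le> \<gamma> * real U" using \<gamma> by (simp add: field_simps)
    then have "2 * real U \<le> \<gamma> * real U * real U" by (intro mult_right_mono) auto
    ultimately have anti_le: "real (card anti) \<le> \<gamma> / 2 * (real U)\<^sup>2" by (simp add: power2_eq_square algebra_simps)
    define W' where "W' = W - anti"
    have "W' \<subseteq> {..<U} \<times> {..<U}" using W(1) by (auto simp: W'_def)
    moreover have "real (card W') \<ge> \<gamma> / 2 * (real U)\<^sup>2"
    proof -
      have "anti \<subseteq> W" by (auto simp: anti_def)
      then have "real (card W') = real (card W) - real (card anti)"
        unfolding W'_def using finW by (simp add: card_Diff_subset finite_subset of_nat_diff card_mono)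
      then show ?thesis using W(2) anti_le by linarith
    qed
    ultimately obtain u0 where u0: "real (card {w\<in>W'. (u0, snd w) \<in> W'}) \<ge> (\<gamma> / 2)\<^sup>2 * (real U)\<^sup>2"
      using dense_star[of W' U "\<gamma> / 2"] U(2) \<gamma> by auto
    define S where "S = {w\<in>W'. (u0, snd w) \<in> W'}"
    have "\<exists>C. is_conic C \<and> (\<forall>i<5. \<alpha> u i \<in> C \<and> \<beta> v i \<in> C)" if "(u, v) \<in> W'" for u v
      using dich that by (auto simp: W'_def)
    then obtain K where K: "\<And>u v. (u, v) \<in> W' \<Longrightarrow> is_conic (K u v)"
      "\<And>u v i. (u, v) \<in> W' \<Longrightarrow> i < 5 \<Longrightarrow> \<alpha> u i \<in> K u v \<and> \<beta> v i \<in> K u v"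
      by metis
    have Krow: "K u v = K u v'" if "(u, v) \<in> W'" "(u, v') \<in> W'" for u v v'
      by (rule conic_through_five_points[of _ "\<alpha> u"]) (use K that nca in \<open>auto simp: W'_def\<close>)
    have Kcol: "K u v = K u' v" if "(u, v) \<in> W'" "(u', v) \<in> W'" for u u' v
      by (rule conic_through_five_points[of _ "\<beta> v"]) (use K that ncb in \<open>auto simp: W'_def\<close>)
    have "(\<gamma> / 2)\<^sup>2 * (real U)\<^sup>2 > 0" using \<gamma> U by simp
    then have "card S \<noteq> 0" using u0 unfolding S_def[symmetric] by linarith
    then have "S \<noteq> {}" by auto
    then obtain v1 where v1: "(u0, v1) \<in> W'" by (auto simp: S_def)
    define C where "C = K u0 v1"
    have SC: "\<alpha> u i \<in> C \<and> \<beta> v i \<in> C" if "(u, v) \<in> S" "i < 5" for u v i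
    proof -
      have "(u, v) \<in> W'" "(u0, v) \<in> W'" using that by (auto simp: S_def)
      then have "K u v = C" using Krow[OF v1] Kcol[of u v u0] by (simp add: C_def)
      then show ?thesis using K(2)[OF \<open>(u, v) \<in> W'\<close> that(2)] by simp
    qed
    \<comment> \<open>Position 0 is the diagonal position that a configuration guarantees to lie in
      \<open>E\<close>.\<close>
    define h where "h w = (fst w * m + \<sigma> 0, snd w * m + \<rho> 0)" for w
    have "inj_on h S"
    proof (rule inj_onI)
      fix w w' assume "h w = h w'"
      then have "fst w * m + \<sigma> 0 = fst w' * m + \<sigma> 0" "snd w * m + \<rho> 0 = snd w' * m + \<rho> 0"
        by (simp_all add: h_def)
      then show "w = w'" using m by (simp add: prod_eq_iff)
    qed
    then have "card (h ` S) = card S" by (rule card_image)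
    moreover have "\<delta> * (real n)\<^sup>2 \<le> (\<gamma> / 2)\<^sup>2 * (real U)\<^sup>2"
    proof -
      have "real n \<le> real U * real m" using nU by (metis of_nat_le_iff of_nat_mult)
      then have "(real n)\<^sup>2 \<le> (real U * real m)\<^sup>2" by (intro power_mono) auto
      then have "\<delta> * (real n)\<^sup>2 \<le> \<delta> * (real U * real m)\<^sup>2" using \<open>\<delta> > 0\<close> by (intro mult_left_mono) auto
      then show ?thesis using m by (simp add: \<delta>_def power_mult_distrib)
    qed
    ultimately have "real (card (h ` S)) \<ge> \<delta> * (real n)\<^sup>2" using u0 by (simp add: S_def)
    moreover have "h ` S \<subseteq> E" using E0 by (auto simp: h_def S_def W'_def)
    moreover have "is_conic C" using K(1) v1 by (simp add: C_def)
    moreover have "\<forall>i j. (i, j) \<in> h ` S \<longrightarrow> a i \<in> C \<and> b j \<in> C"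
    proof (intro allI impI)
      fix i j assume "(i, j) \<in> h ` S"
      then obtain u v where "(u, v) \<in> S" "i = u * m + \<sigma> 0" "j = v * m + \<rho> 0" by (auto simp: h_def)
      then show "a i \<in> C \<and> b j \<in> C" using SC[of u v 0] by (simp add: \<alpha>_def \<beta>_def)
    qed
    ultimately show ?thesis by blast
  qed
  show ?thesis
    by (rule exI[of _ \<delta>], intro conjI exI[of _ "max (max n1 (n2 * m)) 1"] allI impI \<delta>) (rule main)
qed

section \<open>Reduction to two separated arcs\<close>

text \<open>At most \<open>c / 2 * n\<^sup>2\<close> edges have length at most
  \<open>c / 2 * n\<close>. The remaining ones, at least \<open>c / 2 * n\<^sup>2\<close> in number,
  are each separated by more than \<open>c / 2 * n\<close> of the \<open>n\<close> cuts; averaging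
  over the cuts gives the bound.\<close>

lemma ex_popular_cut:
  fixes c :: real
  assumes G: "G \<subseteq> {..<n} \<times> {..<n}" "\<And>i j. (i, j) \<in> G \<Longrightarrow> i < j" and dense: "real (card G) \<ge> c * (real n)\<^sup>2"
    and "c > 0" "n > 0"
  shows "\<exists>h<n. real (card {w\<in>G. fst w \<le> h \<and> h < snd w}) \<ge> c\<^sup>2 / 4 * (real n)\<^sup>2"
proof (rule ccontr)
  assume "\<not> ?thesis"
  then have lt: "real (card {w\<in>G. fst w \<le> h \<and> h < snd w}) < c\<^sup>2 / 4 * (real n)\<^sup>2" if "h < n" for h
    using that by (meson not_less)
  have finG: "finite G" using G(1) finite_subset by blast
  define L where "L = {w\<in>G. real (snd w - fst w) > c / 2 * real n}"
  define k where "k = nat \<lfloor>c / 2 * real n\<rfloor>"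
  have k: "real k \<le> c / 2 * real n" using assms unfolding k_def by (intro of_nat_floor) simp
  have "card (G - L) \<le> card ({..<n} \<times> {1..k})"
  proof (rule card_inj_on_le[where f = "\<lambda>w. (fst w, snd w - fst w)"])
    show "inj_on (\<lambda>w. (fst w, snd w - fst w)) (G - L)"
    proof (rule inj_onI)
      fix w w' assume w: "w \<in> G - L" "w' \<in> G - L" "(fst w, snd w - fst w) = (fst w', snd w' - fst w')"
      then have "fst w < snd w" "fst w' < snd w'" using G(2)[of "fst w" "snd w"] G(2)[of "fst w'" "snd w'"] by auto
      then show "w = w'" using w(3) by (auto simp: prod_eq_iff)
    qed
    show "(\<lambda>w. (fst w, snd w - fst w)) ` (G - L) \<subseteq> {..<n} \<times> {1..k}"
    proof
      fix z assume "z \<in> (\<lambda>w. (fst w, snd w - fst w)) ` (G - L)"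
      then obtain i j where ij: "(i, j) \<in> G" "(i, j) \<notin> L" "z = (i, j - i)" by auto
      then have "i < j" "i < n" "real (j - i) \<le> c / 2 * real n" using G by (auto simp: L_def)
      then have "j - i \<le> k" unfolding k_def by (simp add: le_nat_floor)
      then show "z \<in> {..<n} \<times> {1..k}" using ij \<open>i < j\<close> \<open>i < n\<close> by auto
    qed
  qed simp
  then have "real (card (G - L)) \<le> real n * real k"
    by (metis card_atLeastAtMost card_cartesian_product card_lessThan diff_Suc_1 of_nat_le_iff of_nat_mult)
  also have "\<dots> \<le> real n * (c / 2 * real n)" using k by (intro mult_left_mono) auto
  finally have "real (card (G - L)) \<le> c / 2 * (real n)\<^sup>2" by (simp add: power2_eq_square algebra_simps)
  moreover have "L \<subseteq> G" by (auto simp: L_def)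
  then have "real (card G) = real (card L) + real (card (G - L))"
    using finG by (metis card_Diff_subset card_mono finite_subset le_add_diff_inverse of_nat_add)
  ultimately have L: "real (card L) \<ge> c / 2 * (real n)\<^sup>2" using dense by linarith
  have "c / 2 * (real n)\<^sup>2 * (c / 2 * real n) \<le> real (card L) * (c / 2 * real n)"
    using L assms by (intro mult_right_mono) auto
  also have "\<dots> \<le> (\<Sum>w\<in>L. real (snd w - fst w))"
    using sum_mono[of L "\<lambda>_. c / 2 * real n" "\<lambda>w. real (snd w - fst w)"] by (simp add: L_def less_imp_le)
  also have "\<dots> \<le> (\<Sum>w\<in>G. real (snd w - fst w))"
    using finG \<open>L \<subseteq> G\<close> by (intro sum_mono2) auto
  also have "\<dots> = (\<Sum>w\<in>G. \<Sum>h<n. of_bool (fst w \<le> h \<and> h < snd w))"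
  proof (rule sum.cong[OF refl])
    fix w assume "w \<in> G"
    then have "{h. h < n \<and> fst w \<le> h \<and> h < snd w} = {fst w..<snd w}" using G(1) by (cases w) auto
    then show "real (snd w - fst w) = (\<Sum>h<n. of_bool (fst w \<le> h \<and> h < snd w))"
      by (simp add: sum.If_cases Int_def of_bool_def)
  qed
  also have "\<dots> = (\<Sum>h<n. real (card {w\<in>G. fst w \<le> h \<and> h < snd w}))"
    using finG by (subst sum.swap) (simp add: sum.If_cases Int_def of_bool_def)
  also have "\<dots> < (\<Sum>h<n. c\<^sup>2 / 4 * (real n)\<^sup>2)"
    using lt \<open>n > 0\<close> by (intro sum_strict_mono) auto
  finally show False by (simp add: power2_eq_square algebra_simps)
qed

text \<open>
  On either side of a vertical line the points above and below the line through the extreme points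
  are numbered from left to right or from right to left so that all slopes increase.
\<close>
lemma ex_slope_grid:
  assumes A: "finite A" "convex_position A" "card A = n" and inj: "inj_on (shear_x t) A"
    and ext: "extreme_points t A l u" and F: "F \<subseteq> A \<times> A"
    and cut: "\<And>p q. (p, q) \<in> F \<Longrightarrow> shear_x t p \<le> x \<and> x < shear_x t q"
    and side: "\<And>p q. (p, q) \<in> F \<Longrightarrow> on_or_above t l u p = s \<and> on_or_above t l u q = s'"
  shows "\<exists>a b k k' E. slope_grid n A a b k k' (\<lambda>i j. slope t (a i) (b j)) E \<and>
     bij_betw (\<lambda>(i, j). (a i, b j)) E F"
proof -
  define P where "P = {p\<in>A. shear_x t p \<le> x \<and> on_or_above t l u p = s}"
  define Q where "Q = {q\<in>A. x < shear_x t q \<and> on_or_above t l u q = s'}"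
  have PQ: "P \<subseteq> A" "Q \<subseteq> A" "P \<inter> Q = {}" by (auto simp: P_def Q_def)
  have fin: "finite P" "finite Q" using PQ A finite_subset by blast+
  have injP: "inj_on (\<lambda>p. if s then - shear_x t p else shear_x t p) P"
    and injQ: "inj_on (\<lambda>p. if s' then - shear_x t p else shear_x t p) Q"
    using inj PQ by (auto simp: inj_on_def)
  obtain a where a: "bij_betw a {..<card P} P" "\<And>i j. i < j \<Longrightarrow> j < card P \<Longrightarrow>
      (if s then - shear_x t (a i) else shear_x t (a i)) < (if s then - shear_x t (a j) else shear_x t (a j))"
    using ex_sorted_enumeration[OF fin(1) injP] by blast
  obtain b where b: "bij_betw b {..<card Q} Q" "\<And>i j. i < j \<Longrightarrow> j < card Q \<Longrightarrow>
      (if s' then - shear_x t (b i) else shear_x t (b i)) < (if s' then - shear_x t (b j) else shear_x t (b j))"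
    using ex_sorted_enumeration[OF fin(2) injQ] by blast
  have aP: "a i \<in> P" if "i < card P" for i using a(1) that by (auto simp: bij_betw_def)
  have bQ: "b j \<in> Q" if "j < card Q" for j using b(1) that by (auto simp: bij_betw_def)
  define E where "E = {(i, j). i < card P \<and> j < card Q \<and> (a i, b j) \<in> F}"
  have lt: "shear_x t p < shear_x t q" if "p \<in> P" "q \<in> Q" for p q
    using that by (auto simp: P_def Q_def)
  \<comment> \<open>The middle one of the three points is in \<open>P\<close> here and in
    \<open>Q\<close> for \<open>m2\<close>. Each arc is thus oriented by its own side alone.\<close>
  have m1: "slope t (a i) (b j) < slope t (a i') (b j)" if ij: "i < i'" "i' < card P" "j < card Q" for i i' j
  proof -
    have mem: "a i \<in> P" "a i' \<in> P" "b j \<in> Q" using ij aP bQ by auto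
    then have A': "a i \<in> A" "a i' \<in> A" "b j \<in> A" using PQ by auto
    show ?thesis
    proof (cases s)
      case True
      then have "shear_x t (a i') < shear_x t (a i)" using a(2)[OF ij(1,2)] by simp
      moreover have "on_or_above t l u (a i)" using mem True by (simp add: P_def)
      ultimately show ?thesis using slope_middle(1)[OF A(2) ext A'(2,1,3)] lt mem by blast
    next
      case False
      then have "shear_x t (a i) < shear_x t (a i')" using a(2)[OF ij(1,2)] by simp
      moreover have "\<not> on_or_above t l u (a i')" using mem False by (simp add: P_def)
      ultimately show ?thesis using slope_middle(2)[OF A(2) ext A'] lt mem by blast
    qed
  qed
  have m2: "slope t (a i) (b j) < slope t (a i) (b j')" if ij: "j < j'" "i < card P" "j' < card Q" for i j j'
  proof -
    have mem: "a i \<in> P" "b j \<in> Q" "b j' \<in> Q" using ij aP bQ by auto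
    then have A': "a i \<in> A" "b j \<in> A" "b j' \<in> A" using PQ by auto
    show ?thesis
    proof (cases s')
      case True
      then have "shear_x t (b j') < shear_x t (b j)" using b(2)[OF ij(1,3)] by simp
      moreover have "on_or_above t l u (b j')" using mem True by (simp add: Q_def)
      ultimately show ?thesis using slope_middle(1)[OF A(2) ext A'(1,3,2)] lt mem by blast
    next
      case False
      then have "shear_x t (b j) < shear_x t (b j')" using b(2)[OF ij(1,3)] by simp
      moreover have "\<not> on_or_above t l u (b j)" using mem False by (simp add: Q_def)
      ultimately show ?thesis using slope_middle(2)[OF A(2) ext A'] lt mem by blast
    qed
  qed
  have "slope_grid n A a b (card P) (card Q) (\<lambda>i j. slope t (a i) (b j)) E"
    unfolding slope_grid_def
  proof (intro conjI allI impI m1 m2)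
    show "card P \<le> n" "card Q \<le> n" using PQ A by (auto intro: card_mono)
    show "inj_on a {..<card P}" "inj_on b {..<card Q}" using a(1) b(1) by (auto simp: bij_betw_def)
    show "a ` {..<card P} \<subseteq> A" "b ` {..<card Q} \<subseteq> A" using aP bQ PQ by blast+
    show "a ` {..<card P} \<inter> b ` {..<card Q} = {}" using a(1) b(1) PQ(3) by (simp add: bij_betw_def)
    show "E \<subseteq> {..<card P} \<times> {..<card Q}" by (auto simp: E_def)
  next
    fix i j i' j' assume e: "(i, j) \<in> E" "(i', j') \<in> E" "slope t (a i) (b j) = slope t (a i') (b j')"
    then have "shear_x t (a i) < shear_x t (b j)" "shear_x t (a i') < shear_x t (b j')"
      using aP bQ lt by (auto simp: E_def)
    then show "cross2 (a i - b j) (a i' - b j') = 0" using slope_eq_imp_cross2[OF e(3)] by simp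
  qed (use A in auto)
  moreover have "bij_betw (\<lambda>(i, j). (a i, b j)) E F"
    unfolding bij_betw_def
  proof
    show "inj_on (\<lambda>(i, j). (a i, b j)) E"
      using a(1) b(1) by (auto simp: bij_betw_def inj_on_def E_def)
    show "(\<lambda>(i, j). (a i, b j)) ` E = F"
    proof
      show "(\<lambda>(i, j). (a i, b j)) ` E \<subseteq> F" by (auto simp: E_def)
      show "F \<subseteq> (\<lambda>(i, j). (a i, b j)) ` E"
      proof
        fix w assume w: "w \<in> F"
        obtain p q where pq: "w = (p, q)" by (cases w)
        have "p \<in> P" "q \<in> Q" using w pq F cut[of p q] side[of p q] by (auto simp: P_def Q_def)
        then obtain i j where "i < card P" "p = a i" "j < card Q" "q = b j"
          using a(1) b(1) unfolding bij_betw_def by (metis imageE lessThan_iff)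
        then show "w \<in> (\<lambda>(i, j). (a i, b j)) ` E" using w pq by (force simp: E_def)
      qed
    qed
  qed
  ultimately show ?thesis by blast
qed

text \<open>In the density \<open>c\<^sup>2 / 16\<close> handed on, the cut accounts for
  \<open>c\<^sup>2 / 4\<close> and the choice among the four combinations of sides for a further
  \<open>1 / 4\<close>.\<close>

lemma ordered_pairs_conic:
  fixes c D :: real
  assumes cD: "c > 0" "D > 0"
  shows "\<exists>\<delta>>0. \<exists>n0. \<forall>n\<ge>n0. \<forall>A t F. finite A \<longrightarrow> card A = n \<longrightarrow> convex_position A \<longrightarrow> inj_on (shear_x t) A \<longrightarrow>
    F \<subseteq> A \<times> A \<longrightarrow> (\<forall>p q. (p, q) \<in> F \<longrightarrow> shear_x t p < shear_x t q) \<longrightarrow>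
    real (card ((\<lambda>(p, q). slope t p q) ` F)) \<le> D * real n \<longrightarrow> real (card F) \<ge> c * (real n)\<^sup>2 \<longrightarrow>
    (\<exists>H C. H \<subseteq> F \<and> real (card H) \<ge> \<delta> * (real n)\<^sup>2 \<and> is_conic C \<and> Field H \<subseteq> C)"
proof -
  have c': "c\<^sup>2 / 16 > 0" using cD by simp
  obtain \<delta> n0 where \<delta>: "\<delta> > 0" and main0: "\<forall>n\<ge>n0. \<forall>A a b p q g E. slope_grid n A a b p q g E \<longrightarrow>
    real (card ((\<lambda>(i, j). g i j) ` E)) \<le> D * real n \<longrightarrow> real (card E) \<ge> c\<^sup>2 / 16 * (real n)\<^sup>2 \<longrightarrow>
    (\<exists>H C. H \<subseteq> E \<and> real (card H) \<ge> \<delta> * (real n)\<^sup>2 \<and> is_conic C \<and> (\<forall>i j. (i, j) \<in> H \<longrightarrow> a i \<in> C \<and> b j \<in> C))"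
    using slope_grid_conic[OF c' cD(2)] by (elim exE conjE) (rule that)
  note main = main0[rule_format]
  have "\<exists>H C. H \<subseteq> F \<and> real (card H) \<ge> \<delta> * (real n)\<^sup>2 \<and> is_conic C \<and> Field H \<subseteq> C"
    if n: "n \<ge> max n0 1" and A: "finite A" "card A = n" "convex_position A" and inj: "inj_on (shear_x t) A"
      and F: "F \<subseteq> A \<times> A" and ord: "\<forall>p q. (p, q) \<in> F \<longrightarrow> shear_x t p < shear_x t q"
      and few: "real (card ((\<lambda>(p, q). slope t p q) ` F)) \<le> D * real n"
      and dense: "real (card F) \<ge> c * (real n)\<^sup>2" for n A t F
  proof -
    have n0: "n > 0" using n by simp
    have finF: "finite F" using F A(1) finite_subset by blast
    obtain e where e: "bij_betw e {..<n} A" "\<And>i j. i < j \<Longrightarrow> j < n \<Longrightarrow> shear_x t (e i) < shear_x t (e j)"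
      using ex_sorted_enumeration[OF A(1) inj] A(2) by auto
    have eless: "i < j" if "shear_x t (e i) < shear_x t (e j)" "i < n" "j < n" for i j
      using e(2)[of j i] that by (cases i j rule: linorder_cases) auto
    have eA: "e i \<in> A" if "i < n" for i using e(1) that by (auto simp: bij_betw_def)
    define G where "G = {(i, j). i < n \<and> j < n \<and> (e i, e j) \<in> F}"
    define ee where "ee = (\<lambda>(i, j). (e i, e j))"
    have injee: "inj_on ee ({..<n} \<times> {..<n})" using e(1) by (auto simp: bij_betw_def inj_on_def ee_def)
    have GG: "G \<subseteq> {..<n} \<times> {..<n}" by (auto simp: G_def)
    have imG: "ee ` G = F"
    proof
      show "ee ` G \<subseteq> F" by (auto simp: G_def ee_def)
      show "F \<subseteq> ee ` G"
      proof
        fix w assume w: "w \<in> F"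
        obtain p q where pq: "w = (p, q)" by (cases w)
        then have "p \<in> A" "q \<in> A" using F w by auto
        then obtain i j where "i < n" "p = e i" "j < n" "q = e j"
          using e(1) unfolding bij_betw_def by (metis imageE lessThan_iff)
        then have "(i, j) \<in> G" "w = ee (i, j)" using w pq by (auto simp: G_def ee_def)
        then show "w \<in> ee ` G" by blast
      qed
    qed
    have "card G = card F" using imG card_image[OF inj_on_subset[OF injee GG]] by simp
    then obtain h where h: "h < n" "real (card {w\<in>G. fst w \<le> h \<and> h < snd w}) \<ge> c\<^sup>2 / 4 * (real n)\<^sup>2"
      using ex_popular_cut[OF GG, of c] dense ord cD n0 eless by (auto simp: G_def)
    define x where "x = shear_x t (e h)"
    define Fh where "Fh = {w\<in>F. shear_x t (fst w) \<le> x \<and> x < shear_x t (snd w)}"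
    have finFh: "finite Fh" using finF by (simp add: Fh_def)
    have "ee ` {w\<in>G. fst w \<le> h \<and> h < snd w} \<subseteq> Fh"
    proof
      fix z assume "z \<in> ee ` {w\<in>G. fst w \<le> h \<and> h < snd w}"
      then obtain i j where ij: "z = (e i, e j)" "i < n" "j < n" "(e i, e j) \<in> F" "i \<le> h" "h < j"
        by (auto simp: ee_def G_def)
      moreover have "shear_x t (e i) \<le> x" using e(2)[of i h] ij h(1) by (cases "i = h") (auto simp: x_def)
      moreover have "x < shear_x t (e j)" using e(2)[of h j] ij by (simp add: x_def)
      ultimately show "z \<in> Fh" by (simp add: Fh_def)
    qed
    then have "card {w\<in>G. fst w \<le> h \<and> h < snd w} \<le> card Fh"
      using GG by (intro card_inj_on_le[where f = ee] inj_on_subset[OF injee] finFh) auto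
    then have Fh: "real (card Fh) \<ge> c\<^sup>2 / 4 * (real n)\<^sup>2" using h(2) by linarith
    have "0 < c\<^sup>2 / 4 * (real n)\<^sup>2" using cD n0 by simp
    then have "card Fh \<noteq> 0" using Fh by linarith
    then have Fh0: "Fh \<noteq> {}" by auto
    define l u where "l = e 0" and "u = e (n - 1)"
    have ext: "extreme_points t A l u"
      unfolding extreme_points_def
    proof (intro conjI ballI)
      show "l \<in> A" "u \<in> A" using eA n0 by (auto simp: l_def u_def)
      fix p assume "p \<in> A"
      then obtain i where i: "i < n" "p = e i" using e(1) by (auto simp: bij_betw_def)
      show "shear_x t l \<le> shear_x t p"
        using e(2)[of 0 i] i by (cases "i = 0") (auto simp: l_def)
      have "i = n - 1 \<or> i < n - 1" using i(1) by linarith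
      then show "shear_x t p \<le> shear_x t u"
        using e(2)[of i "n - 1"] i(2) n0 by (auto simp: u_def)
    qed
    define ty where "ty w = (on_or_above t l u (fst w), on_or_above t l u (snd w))" for w
    obtain ss where ss: "real (card {w\<in>Fh. ty w = ss}) \<ge> real (card Fh) / real (card (UNIV :: (bool \<times> bool) set))"
      using pigeonhole_pattern[of Fh UNIV "\<lambda>w q. ty w = q", OF finFh _ _ Fh0] by auto
    define F' where "F' = {w\<in>Fh. ty w = ss}"
    have "CARD(bool \<times> bool) = 4" by simp
    then have F'card: "real (card F') \<ge> c\<^sup>2 / 16 * (real n)\<^sup>2" using ss Fh by (simp add: F'_def)
    have F'F: "F' \<subseteq> F" by (auto simp: F'_def Fh_def)
    have "F' \<subseteq> A \<times> A" using F F'F by blast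
    moreover have "shear_x t p \<le> x \<and> x < shear_x t q" if "(p, q) \<in> F'" for p q
      using that by (simp add: F'_def Fh_def)
    moreover have "on_or_above t l u p = fst ss \<and> on_or_above t l u q = snd ss" if "(p, q) \<in> F'" for p q
      using that by (auto simp: F'_def ty_def)
    ultimately have "\<exists>a b k k' E. slope_grid n A a b k k' (\<lambda>i j. slope t (a i) (b j)) E \<and>
        bij_betw (\<lambda>(i, j). (a i, b j)) E F'"
      by (rule ex_slope_grid[OF A(1,3,2) inj ext])
    then obtain a b k k' E where grid: "slope_grid n A a b k k' (\<lambda>i j. slope t (a i) (b j)) E"
      and bij: "bij_betw (\<lambda>(i, j). (a i, b j)) E F'"
      by (elim exE conjE) (rule that)
    have "(\<lambda>(i, j). slope t (a i) (b j)) ` E = (\<lambda>(p, q). slope t p q) ` (\<lambda>(i, j). (a i, b j)) ` E"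
      by (simp add: image_image case_prod_beta)
    also have "\<dots> \<subseteq> (\<lambda>(p, q). slope t p q) ` F"
      using bij F'F by (simp add: bij_betw_def image_mono)
    finally have "card ((\<lambda>(i, j). slope t (a i) (b j)) ` E) \<le> card ((\<lambda>(p, q). slope t p q) ` F)"
      using finF by (intro card_mono) auto
    then have few': "real (card ((\<lambda>(i, j). slope t (a i) (b j)) ` E)) \<le> D * real n" using few by linarith
    have "card E = card F'" using bij by (rule bij_betw_same_card)
    then obtain H C where HC: "H \<subseteq> E" "real (card H) \<ge> \<delta> * (real n)\<^sup>2" "is_conic C"
      "\<forall>i j. (i, j) \<in> H \<longrightarrow> a i \<in> C \<and> b j \<in> C"
      using main[OF _ grid few'] F'card n by auto
    define H' where "H' = (\<lambda>(i, j). (a i, b j)) ` H"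
    have "card H' = card H"
      unfolding H'_def using bij HC(1) by (intro card_image) (auto simp: bij_betw_def intro: inj_on_subset)
    moreover have "H' \<subseteq> F" using bij HC(1) F'F by (auto simp: H'_def bij_betw_def)
    moreover have "Field H' \<subseteq> C" using HC(4) by (auto simp: H'_def Field_def)
    ultimately show ?thesis using HC by auto
  qed
  then show ?thesis
    by (intro exI[of _ \<delta>] conjI exI[of _ "max n0 1"] allI impI \<delta>)
qed

theorem theorem4p5:
  fixes D c :: real
  assumes "D > 0" and "c > 0"
  shows "\<exists>\<delta>>0. \<exists>n0 :: nat. \<forall>(n :: nat) (A :: (real ^ 2) set) E.
           finite A \<and> card A = n \<and> convex_position A \<and> E \<subseteq> A \<times> A \<and>
           real (card (directions E)) \<le> D * real n \<and>
           n \<ge> n0 \<and> real (card E) \<ge> c * (real n)\<^sup>2 \<longrightarrow>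
           (\<exists>H C. H \<subseteq> E \<and> real (card H) \<ge> \<delta> * (real n)\<^sup>2 \<and>
                  is_conic C \<and> Field H \<subseteq> C)"
proof -
  \<comment> \<open>Diagonal pairs number at most \<open>n\<close>, which is at most half of
    \<open>c * n\<^sup>2\<close> once \<open>n \<ge> 2 / c\<close>. One of the two orientations then
    keeps a quarter.\<close>
  have c4: "c / 4 > 0" using assms by simp
  obtain \<delta> n0 where \<delta>: "\<delta> > 0" and main0: "\<forall>n\<ge>n0. \<forall>A t F. finite A \<longrightarrow> card A = n \<longrightarrow> convex_position A \<longrightarrow>
    inj_on (shear_x t) A \<longrightarrow> F \<subseteq> A \<times> A \<longrightarrow> (\<forall>p q. (p, q) \<in> F \<longrightarrow> shear_x t p < shear_x t q) \<longrightarrow>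
    real (card ((\<lambda>(p, q). slope t p q) ` F)) \<le> D * real n \<longrightarrow> real (card F) \<ge> c / 4 * (real n)\<^sup>2 \<longrightarrow>
    (\<exists>H C. H \<subseteq> F \<and> real (card H) \<ge> \<delta> * (real n)\<^sup>2 \<and> is_conic C \<and> Field H \<subseteq> C)"
    using ordered_pairs_conic[OF c4 assms(1)] by (elim exE conjE) (rule that)
  note main = main0[rule_format]
  obtain n1 :: nat where n1: "2 / c < real n1" using reals_Archimedean2 by blast
  have "\<exists>H C. H \<subseteq> E \<and> real (card H) \<ge> \<delta> * (real n)\<^sup>2 \<and> is_conic C \<and> Field H \<subseteq> C"
    if A: "finite A" "card A = n" "convex_position A" and E: "E \<subseteq> A \<times> A"
      and few: "real (card (directions E)) \<le> D * real n" and n: "n \<ge> max n0 n1"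
      and dense: "real (card E) \<ge> c * (real n)\<^sup>2" for n A E
  proof -
    obtain t where t: "inj_on (shear_x t) A" using ex_injective_shear[OF A(1)] by blast
    have finE: "finite E" using E A(1) finite_subset by blast
    define E1 where "E1 = {(p, q)\<in>E. shear_x t p < shear_x t q}"
    define E2 where "E2 = {(p, q)\<in>E. shear_x t q < shear_x t p}"
    have "E \<subseteq> (E1 \<union> E2) \<union> (\<lambda>p. (p, p)) ` A"
    proof
      fix w assume "w \<in> E"
      then obtain p q where "w = (p, q)" "(p, q) \<in> E" "p \<in> A" "q \<in> A" using E by auto
      then show "w \<in> (E1 \<union> E2) \<union> (\<lambda>p. (p, p)) ` A"
        using t by (cases "shear_x t p" "shear_x t q" rule: linorder_cases) (auto simp: E1_def E2_def inj_on_def)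
    qed
    moreover have fin12: "finite E1" "finite E2" using finE by (auto simp: E1_def E2_def intro: finite_subset)
    ultimately have "card E \<le> card ((E1 \<union> E2) \<union> (\<lambda>p. (p, p)) ` A)" using A by (intro card_mono) auto
    also have "\<dots> \<le> (card E1 + card E2) + card A"
      by (meson add_mono card_Un_le card_image_le A(1) order_trans)
    finally have sum: "real (card E) \<le> real (card E1) + real (card E2) + real n" using A(2) by linarith
    have "2 / c \<le> real n" using n n1 by linarith
    then have "2 \<le> c * real n" using assms by (simp add: field_simps)
    then have "2 * real n \<le> c * real n * real n" by (intro mult_right_mono) auto
    then have "real n \<le> c / 2 * (real n)\<^sup>2" by (simp add: power2_eq_square)
    then consider "real (card E1) \<ge> c / 4 * (real n)\<^sup>2" | "real (card E2) \<ge> c / 4 * (real n)\<^sup>2"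
      using sum dense by linarith
    then show ?thesis
    proof cases
      case 1
      have "card ((\<lambda>(p, q). slope t p q) ` E1) \<le> card (directions E)"
        by (rule card_slopes_le[OF finE]) (auto simp: E1_def)
      then have "\<exists>H C. H \<subseteq> E1 \<and> real (card H) \<ge> \<delta> * (real n)\<^sup>2 \<and> is_conic C \<and> Field H \<subseteq> C"
        using n few E 1 by (intro main[OF _ A t]) (auto simp: E1_def)
      then show ?thesis by (auto simp: E1_def)
    next
      case 2
      \<comment> \<open>Slopes ignore the order of the points, so the reversed pairs determine the
        same slopes; reversing \<open>H\<close> back leaves its \<open>Field\<close>
        unchanged.\<close>
      have "(\<lambda>(p, q). slope t p q) ` E2\<inverse> = (\<lambda>(p, q). slope t p q) ` E2"
      proof -
        have "E2\<inverse> = prod.swap ` E2" by force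
        then have "(\<lambda>(p, q). slope t p q) ` E2\<inverse> = (\<lambda>w. slope t (snd w) (fst w)) ` E2"
          by (simp add: image_image case_prod_beta)
        also have "\<dots> = (\<lambda>(p, q). slope t p q) ` E2"
          by (intro image_cong refl) (simp add: case_prod_beta slope_commute)
        finally show ?thesis .
      qed
      moreover have "card ((\<lambda>(p, q). slope t p q) ` E2) \<le> card (directions E)"
        by (rule card_slopes_le[OF finE]) (auto simp: E2_def)
      ultimately have "\<exists>H C. H \<subseteq> E2\<inverse> \<and> real (card H) \<ge> \<delta> * (real n)\<^sup>2 \<and> is_conic C \<and> Field H \<subseteq> C"
        using n few E 2 by (intro main[OF _ A t]) (auto simp: E2_def)
      then obtain H C where "H \<subseteq> E2\<inverse>" "real (card H) \<ge> \<delta> * (real n)\<^sup>2" "is_conic C" "Field H \<subseteq> C" by blast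
      then show ?thesis by (intro exI[of _ "H\<inverse>"] exI[of _ C]) (auto simp: E2_def)
    qed
  qed
  then show ?thesis
    by (intro exI[of _ \<delta>] conjI exI[of _ "max n0 n1"] allI impI \<delta>) (elim conjE)
qed

end
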